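(* Let $\mathbf{G}_s$ denote the set of elements $g$ of the $n\times n\times n$ Rubik's Cube group $\mathbf{G}$ that do not change the physical appearance of the cube, i.e. such that applying $g$ to the solved cube yields a cube with the same color at every facelet. Then $|\mathbf{G}_s| = \left(\frac{24^6}{2}\right)^{\frac{(n-3)(n-1)}{4}}$ for odd $n\ge 3$, and $|\mathbf{G}_s| = \left(\frac{24^6}{2}\right)^{\frac{(n-2)^2}{4}}$ for even $n\ge 2$.
   Context: The $n\times n\times n$ Rubik's Cube has faces U, D, F, B, R, L, each an $n\times n$ grid of facelets carrying stickers ($6n^2$ in total); in the solved state each face is monochromatic and the six faces have six distinct colors. For $1\le k\le\lfloor n/2\rfloor$, $F_k,B_k,R_k,L_k,U_k,D_k$ denote clockwise (seen from the named face) $90^\circ$ rotations of the $k$-th $n\times n\times 1$ slice counted from the named face. $\mathbf{G}$ is the subgroup of the symmetric group on the facelets generated by the facelet permutations induced by these moves. *)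

theory Defs
  imports "HOL-Combinatorics.Permutations" "HOL-Algebra.Generated_Groups"
begin

datatype cube_face = Up | Down | Front | Back | Right | Left

text \<open>
  The cube is placed in space as \<open>[-n, n]\<^sup>3\<close>, so that each of the small cubes has side
  length 2, with the \<open>x\<close>-axis pointing to the right, the \<open>y\<close>-axis upwards and the \<open>z\<close>-axis
  to the front. A facelet is represented by its midpoint: one coordinate is \<open>n\<close> or \<open>-n\<close> and the
  other two lie in \<open>{-(n-1), -(n-3), ..., n-3, n-1}\<close>.
\<close>

type_synonym facelet = "int \<times> int \<times> int"

definition grid :: "nat \<Rightarrow> int set" where
  "grid n = (\<lambda>i. 2 * int i - int n - 1) ` {1..n}"

primrec face_facelets :: "nat \<Rightarrow> cube_face \<Rightarrow> facelet set" where
  "face_facelets n Up    = grid n \<times> {int n} \<times> grid n"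
| "face_facelets n Down  = grid n \<times> {- int n} \<times> grid n"
| "face_facelets n Front = grid n \<times> grid n \<times> {int n}"
| "face_facelets n Back  = grid n \<times> grid n \<times> {- int n}"
| "face_facelets n Right = {int n} \<times> grid n \<times> grid n"
| "face_facelets n Left  = {- int n} \<times> grid n \<times> grid n"

definition facelets :: "nat \<Rightarrow> facelet set" where
  "facelets n = (\<Union>f. face_facelets n f)"

text \<open>Coordinate along the outward normal of a face.\<close>

fun height :: "cube_face \<Rightarrow> facelet \<Rightarrow> int" where
  "height Up    (x, y, z) = y"
| "height Down  (x, y, z) = - y"
| "height Front (x, y, z) = z"
| "height Back  (x, y, z) = - z"
| "height Right (x, y, z) = x"
| "height Left  (x, y, z) = - x"

text \<open>Quarter turn of space, clockwise when looking at the named face from outside.\<close>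

fun quarter_turn :: "cube_face \<Rightarrow> facelet \<Rightarrow> facelet" where
  "quarter_turn Up    (x, y, z) = (- z, y, x)"
| "quarter_turn Down  (x, y, z) = (z, y, - x)"
| "quarter_turn Front (x, y, z) = (y, - x, z)"
| "quarter_turn Back  (x, y, z) = (- y, x, z)"
| "quarter_turn Right (x, y, z) = (x, z, - y)"
| "quarter_turn Left  (x, y, z) = (x, - z, y)"

text \<open>
  The slab occupied by the \<open>k\<close>-th slice counted from a face. For \<open>1 \<le> k \<le> n div 2\<close> no facelet
  midpoint lies on the plane between two slices, and the outermost slab (\<open>k = 1\<close>) contains the
  facelets of the named face itself.
\<close>

definition slice :: "nat \<Rightarrow> cube_face \<Rightarrow> nat \<Rightarrow> facelet set" where
  "slice n f k = {p. int n - 2 * int k \<le> height f p \<and> height f p \<le> int n - 2 * (int k - 1)}"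

definition move :: "nat \<Rightarrow> cube_face \<Rightarrow> nat \<Rightarrow> facelet \<Rightarrow> facelet" where
  "move n f k p = (if p \<in> facelets n \<and> p \<in> slice n f k then quarter_turn f p else p)"

definition cube_moves :: "nat \<Rightarrow> (facelet \<Rightarrow> facelet) set" where
  "cube_moves n = {move n f k | f k. 1 \<le> k \<and> k \<le> n div 2}"

definition facelet_sym_group :: "nat \<Rightarrow> (facelet \<Rightarrow> facelet) monoid" where
  "facelet_sym_group n =
     \<lparr>carrier = {g. g permutes facelets n}, mult = (\<circ>), one = id\<rparr>"

definition cube_group :: "nat \<Rightarrow> (facelet \<Rightarrow> facelet) set" where
  "cube_group n = generate (facelet_sym_group n) (cube_moves n)"

definition solved :: "nat \<Rightarrow> (cube_face \<Rightarrow> 'c) \<Rightarrow> facelet \<Rightarrow> 'c" where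
  "solved n col p = col (THE f. p \<in> face_facelets n f)"

text \<open>The sticker at \<open>p\<close> is carried to \<open>g p\<close>, so the new colour at \<open>q\<close> is the old one at
  the preimage of \<open>q\<close>.\<close>

definition apply_to :: "nat \<Rightarrow> (facelet \<Rightarrow> facelet) \<Rightarrow> (facelet \<Rightarrow> 'c) \<Rightarrow> facelet \<Rightarrow> 'c" where
  "apply_to n g c q = c (inv_into (facelets n) g q)"

definition appearance_preserving :: "nat \<Rightarrow> (cube_face \<Rightarrow> 'c) \<Rightarrow> (facelet \<Rightarrow> facelet) set" where
  "appearance_preserving n col =
     {g \<in> cube_group n. \<forall>q \<in> facelets n. apply_to n g (solved n col) q = solved n col q}"

lemma grid_uminus: "x \<in> grid n \<Longrightarrow> - x \<in> grid n"
  unfolding grid_def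
proof (elim imageE)
  fix i assume "x = 2 * int i - int n - 1" "i \<in> {1..n}"
  then show "- x \<in> (\<lambda>i. 2 * int i - int n - 1) ` {1..n}"
    by (intro image_eqI[of _ _ "n + 1 - i"]) (auto simp: of_nat_diff)
qed

lemma grid_uminus_iff [simp]: "- x \<in> grid n \<longleftrightarrow> x \<in> grid n"
  using grid_uminus[of x n] grid_uminus[of "- x" n] by auto

lemma grid_bounds: "x \<in> grid n \<Longrightarrow> - int n < x \<and> x < int n"
  by (auto simp: grid_def)

lemma n_notin_grid [simp]: "int n \<notin> grid n"
  using grid_bounds by blast

lemma grid_0: "grid 0 = {}"
  by (simp add: grid_def)

lemma card_grid: "card (grid n) = n"
  unfolding grid_def by (subst card_image) (auto simp: inj_on_def)

lemma finite_grid [simp]: "finite (grid n)"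
  by (simp add: grid_def)

lemma UNIV_cube_face: "UNIV = {Up, Down, Front, Back, Right, Left}"
  using cube_face.exhaust by auto

lemma facelets_iff:
  "(x, y, z) \<in> facelets n \<longleftrightarrow>
     x \<in> grid n \<and> y \<in> grid n \<and> \<bar>z\<bar> = int n \<or>
     x \<in> grid n \<and> z \<in> grid n \<and> \<bar>y\<bar> = int n \<or>
     y \<in> grid n \<and> z \<in> grid n \<and> \<bar>x\<bar> = int n"
proof -
  have "\<bar>w\<bar> = int n \<longleftrightarrow> w = int n \<or> w = - int n" for w
    by arith
  then show ?thesis
    by (simp add: facelets_def UNIV_cube_face) blast
qed

lemma face_facelets_disjoint:
  assumes "p \<in> face_facelets n f" and "p \<in> face_facelets n f'"
  shows "f = f'"
  using assms by (cases f; cases f'; cases p) (auto simp: grid_0)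

lemma solved_eq: "p \<in> face_facelets n f \<Longrightarrow> solved n col p = col f"
  unfolding solved_def by (metis (mono_tags, lifting) face_facelets_disjoint the_equality)

lemma card_face_facelets: "card (face_facelets n f) = n ^ 2"
  by (cases f) (simp_all add: card_cartesian_product card_grid power2_eq_square)

lemma finite_face_facelets: "finite (face_facelets n f)"
  by (cases f) simp_all

lemma card_facelets: "card (facelets n) = 6 * n ^ 2"
proof -
  have "card (facelets n) = (\<Sum>f\<in>UNIV. card (face_facelets n f))"
    unfolding facelets_def
    by (rule card_UN_disjoint)
       (auto simp: UNIV_cube_face finite_face_facelets grid_0)
  also have "\<dots> = 6 * n ^ 2"
    by (simp add: card_face_facelets UNIV_cube_face)
  finally show ?thesis .
qed

lemma finite_facelets: "finite (facelets n)"
  by (simp add: facelets_def UNIV_cube_face finite_face_facelets)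

lemma quarter_turn_facelets: "quarter_turn f p \<in> facelets n \<longleftrightarrow> p \<in> facelets n"
  by (cases p; cases f) (auto simp: facelets_iff)

lemma quarter_turn_slice: "quarter_turn f p \<in> slice n f k \<longleftrightarrow> p \<in> slice n f k"
  by (cases p; cases f) (auto simp: slice_def)

lemma quarter_turn_inj: "quarter_turn f p = quarter_turn f q \<Longrightarrow> p = q"
  by (cases p; cases q; cases f) auto

lemma move_permutes: "move n f k permutes facelets n"
proof (rule bij_imp_permutes)
  have inj: "inj_on (move n f k) (facelets n)"
    by (rule inj_onI)
       (metis move_def quarter_turn_inj quarter_turn_slice)
  have "move n f k ` facelets n \<subseteq> facelets n"
    by (auto simp: move_def quarter_turn_facelets)
  then have "move n f k ` facelets n = facelets n"
    using inj finite_facelets endo_inj_surj by blast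
  with inj show "bij_betw (move n f k) (facelets n) (facelets n)"
    by (simp add: bij_betw_def)
qed (simp add: move_def)

lemma group_facelet_sym_group: "group (facelet_sym_group n)"
proof (rule groupI)
  fix g assume "g \<in> carrier (facelet_sym_group n)"
  then have g: "g permutes facelets n" by (simp add: facelet_sym_group_def)
  then show "\<exists>h \<in> carrier (facelet_sym_group n).
      h \<otimes>\<^bsub>facelet_sym_group n\<^esub> g = \<one>\<^bsub>facelet_sym_group n\<^esub>"
    by (intro bexI[of _ "inv_into UNIV g"])
       (simp_all add: facelet_sym_group_def permutes_inv permutes_inv_o)
qed (auto simp: facelet_sym_group_def permutes_compose permutes_id)

lemma subgroup_cube_group: "subgroup (cube_group n) (facelet_sym_group n)"
  unfolding cube_group_def
  by (rule group.generate_is_subgroup[OF group_facelet_sym_group])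
     (auto simp: cube_moves_def facelet_sym_group_def move_permutes)

end

theory Submission
  imports Defs
begin

text \<open>
  Every move acts on a facelet as a rotation of the cube or trivially, so the 24 rotations split the
  facelets into orbits that the group preserves; away from the face centres such an orbit has 24
  elements, four on each face. An element that preserves the appearance fixes every facelet of a
  corner or edge, because the facelets of one small cube travel together and their faces determine
  their position. Hence it only permutes the inner orbits, within each face.

  On the orbit of \<open>(a, b, n)\<close> the sign of a move is \<open>\<chi>(a) \<chi>(b) \<chi>(n)\<close>, where \<open>\<chi>(c)\<close> records the
  slices at heights \<open>c\<close> and \<open>-c\<close>. Therefore the sign on an inner orbit is a product of signs on
  orbits of edge and corner facelets, and an appearance preserving element is even on each inner
  orbit. Conversely all even permutations of an inner orbit occur: the commutator of the slice turn
  at \<open>x = a\<close> with the slice turn at \<open>x = -b\<close>, conjugated by a turn of the front face, is a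
  three-cycle, because the supports of the two meet in a single facelet, and its conjugates under the
  rotations of the cube connect the whole orbit. So each inner orbit contributes the factor
  \<open>4!\<^sup>6 / 2\<close>.
\<close>

unbundle no m_inv_syntax

section \<open>Permutation groups containing a three-cycle\<close>

definition cyc3 :: "'a \<Rightarrow> 'a \<Rightarrow> 'a \<Rightarrow> 'a \<Rightarrow> 'a" where
  "cyc3 a b c = transpose a b \<circ> transpose b c"

lemma cyc3_apply:
  assumes "a \<noteq> b" "b \<noteq> c" "a \<noteq> c"
  shows "cyc3 a b c x = (if x = a then b else if x = b then c else if x = c then a else x)"
  using assms by (auto simp: cyc3_def transpose_def)

lemma cyc3_rotate: "a \<noteq> b \<Longrightarrow> b \<noteq> c \<Longrightarrow> a \<noteq> c \<Longrightarrow> cyc3 a b c = cyc3 b c a"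
  by (auto simp: fun_eq_iff cyc3_apply)

lemma cyc3_permutes: "a \<in> S \<Longrightarrow> b \<in> S \<Longrightarrow> c \<in> S \<Longrightarrow> cyc3 a b c permutes S"
  by (simp add: cyc3_def permutes_compose permutes_swap_id)

lemma evenperm_cyc3: "a \<noteq> b \<Longrightarrow> b \<noteq> c \<Longrightarrow> evenperm (cyc3 a b c)"
  by (simp add: cyc3_def evenperm_comp permutation_swap_id evenperm_swap)

lemma comp_cyc3:
  assumes "inj r" "a \<noteq> b" "b \<noteq> c" "a \<noteq> c"
  shows "r \<circ> cyc3 a b c = cyc3 (r a) (r b) (r c) \<circ> r"
proof
  have "r a \<noteq> r b" "r b \<noteq> r c" "r a \<noteq> r c" using assms by (simp_all add: inj_eq)
  then show "(r \<circ> cyc3 a b c) x = (cyc3 (r a) (r b) (r c) \<circ> r) x" for x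
    using assms by (simp add: cyc3_apply inj_eq)
qed

lemma commutator_cyc3:
  assumes f: "inj f" and g: "inj g" and "f p \<noteq> p" "g p \<noteq> p"
    and only: "\<And>q. f q \<noteq> q \<Longrightarrow> g q \<noteq> q \<Longrightarrow> q = p"
  shows "f \<circ> g = cyc3 p (f p) (g p) \<circ> (g \<circ> f)"
    and "f p \<noteq> g p"
proof -
  have gfp: "g (f p) = f p" and fgp: "f (g p) = g p"
    using only[of "f p"] only[of "g p"] assms(3,4) inj_eq[OF f, of "f p" p] inj_eq[OF g, of "g p" p] by auto
  show ne: "f p \<noteq> g p"
    using gfp assms(3) inj_eq[OF g, of "f p" p] by auto
  show "f \<circ> g = cyc3 p (f p) (g p) \<circ> (g \<circ> f)"
  proof
    fix q
    have c: "cyc3 p (f p) (g p) x = (if x = p then f p else if x = f p then g p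
        else if x = g p then p else x)" for x
      by (rule cyc3_apply) (use assms(3,4) ne in auto)
    consider "q = p" | "q \<noteq> p" "g q = p" | "q \<noteq> p" "f q = p"
      | "q \<noteq> p" "g q \<noteq> p" "f q \<noteq> p" "f q = q" | "q \<noteq> p" "g q \<noteq> p" "f q \<noteq> p" "f q \<noteq> q"
      by blast
    then show "(f \<circ> g) q = (cyc3 p (f p) (g p) \<circ> (g \<circ> f)) q"
    proof cases
      case 1 then show ?thesis using gfp fgp assms(3,4) by (simp add: c)
    next
      case 2 then have "f q = q" using only[of q] by auto
      with 2 show ?thesis by (simp add: c)
    next
      case 3 then have "g q = q" using only[of q] by auto
      with 3 show ?thesis using assms(3,4) ne by (simp add: c)
    next
      case 4
      then have "f (g q) = g q" using only[of "g q"] inj_eq[OF g, of "g q" q] by auto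
      moreover have "g q \<noteq> f p" 
      proof
        assume "g q = f p"
        then have "q = f p" using gfp inj_eq[OF g, of q "f p"] by simp
        then show False using 4 assms(3) inj_eq[OF f, of "f p" p] by simp
      qed
      moreover have "g q \<noteq> g p" using 4 inj_eq[OF g, of q p] by auto
      ultimately show ?thesis using 4 by (simp add: c)
    next
      case 5
      then have "g q = q" "g (f q) = f q" using only[of q] only[of "f q"] inj_eq[OF f, of "f q" q] by auto
      moreover have "f q \<noteq> f p" "f q \<noteq> g p"
        using 5 fgp inj_eq[OF f, of q p] inj_eq[OF f, of q "g p"] by auto
      ultimately show ?thesis using 5 by (simp add: c)
    qed
  qed
qed

locale perm_group =
  fixes H :: "('a \<Rightarrow> 'a) set"
  assumes id_mem: "id \<in> H"
    and comp_mem: "\<And>f g. f \<in> H \<Longrightarrow> g \<in> H \<Longrightarrow> f \<circ> g \<in> H"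
    and inv_mem: "\<And>f. f \<in> H \<Longrightarrow> inv f \<in> H"
    and bij_mem: "\<And>f. f \<in> H \<Longrightarrow> bij f"
begin

lemma comp_mem_cancel_left: "f \<in> H \<Longrightarrow> f \<circ> g \<in> H \<Longrightarrow> g \<in> H"
  using comp_mem[OF inv_mem, of f "f \<circ> g"] bij_mem[of f]
  by (simp add: comp_assoc[symmetric] bij_is_inj)

lemma comp_mem_cancel_right: "g \<in> H \<Longrightarrow> f \<circ> g \<in> H \<Longrightarrow> f \<in> H"
  using comp_mem[OF _ inv_mem, of "f \<circ> g" g] bij_mem[of g]
  by (simp add: comp_assoc bij_is_surj surj_iff[THEN iffD1])

definition contains_alt :: "'a set \<Rightarrow> bool" where
  "contains_alt S \<longleftrightarrow> (\<forall>f. f permutes S \<longrightarrow> evenperm f \<longrightarrow> f \<in> H)"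

lemma contains_alt_cyc3:
  assumes "contains_alt S" "a \<in> S" "b \<in> S" "c \<in> S" "a \<noteq> b" "b \<noteq> c"
  shows "cyc3 a b c \<in> H"
  using assms cyc3_permutes[of a S b c] evenperm_cyc3[of a b c] unfolding contains_alt_def by blast

lemma contains_alt_insert:
  assumes "finite S" and alt: "contains_alt S" and ab: "a \<in> S" "b \<in> S" "a \<noteq> b"
    and x: "x \<notin> S" "cyc3 a b x \<in> H"
  shows "contains_alt (insert x S)"
  unfolding contains_alt_def
proof (intro allI impI)
  fix f assume f: "f permutes insert x S" "evenperm f"
  have abx: "cyc3 a b x permutes insert x S" "evenperm (cyc3 a b x)"
    using ab x by (auto intro!: cyc3_permutes evenperm_cyc3)
  have nx: "a \<noteq> x" "b \<noteq> x" using ab x by auto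
  have perm: "permutation h" if "h permutes insert x S" for h
    using permutes_imp_permutation[OF _ that] assms(1) by simp
  have "\<exists>t\<in>H. t permutes insert x S \<and> evenperm t \<and> t (f x) = x"
  proof -
    have "f x \<in> insert x S" using permutes_in_image[OF f(1), of x] by blast
    then consider "f x = x" | "f x = a" | "f x = b" | "f x \<in> S" "f x \<noteq> a" "f x \<noteq> b" by blast
    then show ?thesis
    proof cases
      case 1 then show ?thesis using id_mem by (intro bexI[of _ id]) auto
    next
      case 2
      have "(cyc3 a b x \<circ> cyc3 a b x) a = x"
        using ab nx cyc3_apply[of a b x] by auto
      moreover have "evenperm (cyc3 a b x \<circ> cyc3 a b x)"
        using perm[OF abx(1)] abx(2) by (simp add: evenperm_comp)
      ultimately show ?thesis
        using 2 abx x comp_mem permutes_compose by (intro bexI[of _ "cyc3 a b x \<circ> cyc3 a b x"]) auto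
    next
      case 3
      have "cyc3 a b x b = x" using ab nx cyc3_apply[of a b x] by auto
      then show ?thesis using 3 abx x by (intro bexI[of _ "cyc3 a b x"]) auto
    next
      case 4
      let ?c = "cyc3 (f x) b a"
      have c: "?c \<in> H" "?c permutes insert x S" "evenperm ?c"
        using 4 ab alt by (auto intro!: contains_alt_cyc3 cyc3_permutes evenperm_cyc3)
      have "(cyc3 a b x \<circ> ?c) (f x) = x"
        using ab nx 4 cyc3_apply[of a b x] cyc3_apply[of "f x" b a] by auto
      moreover have "evenperm (cyc3 a b x \<circ> ?c)"
        using perm[OF abx(1)] abx(2) perm[OF c(2)] c(3) by (simp add: evenperm_comp)
      ultimately show ?thesis
        using abx c x comp_mem permutes_compose by (intro bexI[of _ "cyc3 a b x \<circ> ?c"]) auto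
    qed
  qed
  then obtain t where t: "t \<in> H" "t permutes insert x S" "evenperm t" "t (f x) = x" by blast
  have tf: "t \<circ> f permutes insert x S" using t f permutes_compose by blast
  have "t \<circ> f permutes S"
    by (rule permutes_superset[OF tf]) (use t in auto)
  moreover have "evenperm (t \<circ> f)"
    using perm[OF t(2)] t(3) perm[OF f(1)] f(2) by (simp add: evenperm_comp)
  ultimately have "t \<circ> f \<in> H" using alt unfolding contains_alt_def by blast
  then show "f \<in> H" using t comp_mem_cancel_left by blast
qed

lemma contains_alt_triple:
  assumes "cyc3 a b c \<in> H" "a \<noteq> b" "b \<noteq> c" "a \<noteq> c"
  shows "contains_alt {a, b, c}"
proof -
  have "contains_alt {a, b}"
    using assms id_mem by (auto simp: contains_alt_def permutes_doubleton_iff evenperm_swap)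
  then have "contains_alt (insert c {a, b})"
    using assms by (intro contains_alt_insert[of "{a, b}" a b c]) auto
  then show ?thesis by (simp add: insert_commute)
qed

lemma cyc3_square_mem:
  assumes "cyc3 a b c \<in> H" "a \<noteq> b" "b \<noteq> c" "a \<noteq> c"
  shows "cyc3 a c b \<in> H"
proof -
  have "cyc3 a c b = cyc3 a b c \<circ> cyc3 a b c" using assms by (auto simp: fun_eq_iff cyc3_apply)
  then show ?thesis using assms comp_mem by simp
qed

lemma contains_alt_Un:
  assumes S: "finite S" "card S \<ge> 3" "contains_alt S"
    and H: "cyc3 a b c \<in> H" and ne: "a \<noteq> b" "b \<noteq> c" "a \<noteq> c"
    and "a \<in> S"
  shows "contains_alt (S \<union> {a, b, c})"
proof -
  have H': "cyc3 a c b \<in> H" using cyc3_square_mem H ne by blast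
  consider "b \<in> S" "c \<in> S" | "b \<in> S" "c \<notin> S" | "b \<notin> S" "c \<in> S" | "b \<notin> S" "c \<notin> S" by blast
  then show ?thesis
  proof cases
    case 1 then have "S \<union> {a, b, c} = S" using \<open>a \<in> S\<close> by auto
    then show ?thesis using S by simp
  next
    case 2 then have "S \<union> {a, b, c} = insert c S" using \<open>a \<in> S\<close> by auto
    then show ?thesis using contains_alt_insert[OF S(1,3) \<open>a \<in> S\<close> _ _ _ H] 2 ne by metis
  next
    case 3 then have "S \<union> {a, b, c} = insert b S" using \<open>a \<in> S\<close> by auto
    then show ?thesis using contains_alt_insert[OF S(1,3) \<open>a \<in> S\<close> _ _ _ H'] 3 ne by metis
  next
    case 4
    have "card (S - {a}) \<ge> 2" using S \<open>a \<in> S\<close> by simp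
    then obtain d e where de: "d \<in> S - {a}" "e \<in> S - {a}" "d \<noteq> e"
      using card_le_Suc0_iff_eq[of "S - {a}"] S(1) by auto
    let ?f = "cyc3 a b c" and ?g = "cyc3 a d e"
    have g: "?g \<in> H" by (rule contains_alt_cyc3[OF S(3)]) (use \<open>a \<in> S\<close> de in auto)
    have fa: "?f a = b" "?g a = d" using ne de by (auto simp: cyc3_apply)
    have "?f \<circ> ?g = cyc3 a (?f a) (?g a) \<circ> (?g \<circ> ?f)"
    proof (rule commutator_cyc3)
      show "inj ?f" "inj ?g" using H g bij_mem bij_is_inj by blast+
      show "?f a \<noteq> a" "?g a \<noteq> a" using fa ne de by auto
      show "q = a" if "?f q \<noteq> q" "?g q \<noteq> q" for q
        using that ne de 4 by (auto simp: cyc3_apply split: if_splits)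
    qed
    then have "cyc3 a b d \<in> H" 
      using comp_mem_cancel_right[OF comp_mem[OF g H], of "cyc3 a b d"] comp_mem[OF H g]
      by (simp add: fa)
    then have "cyc3 a d b \<in> H" 
      by (rule cyc3_square_mem) (use ne de 4 in auto)
    then have "contains_alt (insert b S)" 
      by (intro contains_alt_insert[OF S(1,3) \<open>a \<in> S\<close>]) (use de 4 in auto)
    then have "contains_alt (insert c (insert b S))"
      by (intro contains_alt_insert[OF _ _ _ _ _ _ H]) (use S ne 4 \<open>a \<in> S\<close> in auto)
    moreover have "S \<union> {a, b, c} = insert c (insert b S)" using \<open>a \<in> S\<close> by auto
    ultimately show ?thesis by simp
  qed
qed

end

section \<open>Counting and signs of permutations\<close>

lemma permutes_restrict_id_subset:
  assumes "f permutes S" "finite A" "f ` A \<subseteq> A"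
  shows "restrict_id f A permutes A"
proof (rule permutes_restrict_id)
  have "inj_on f A" using permutes_inj_on[OF assms(1)] by blast
  then show "bij_betw f A A" using assms endo_inj_surj[of A f] by (simp add: bij_betw_def)
qed

lemma card_permutes_preserving_partition:
  assumes "finite I" "\<And>i. i \<in> I \<Longrightarrow> finite (A i)" "disjoint_family_on A I"
  shows "card {f. f permutes (\<Union>i\<in>I. A i) \<and> (\<forall>i\<in>I. f ` A i \<subseteq> A i \<and> P i (restrict_id f (A i)))} =
    (\<Prod>i\<in>I. card {f. f permutes A i \<and> P i f})"
  using assms
proof (induction I rule: finite_induct)
  case empty
  then show ?case by simp
next
  case (insert j I)
  let ?U = "\<Union>i\<in>I. A i"
  let ?X = "\<lambda>I. {f. f permutes (\<Union>i\<in>I. A i) \<and> (\<forall>i\<in>I. f ` A i \<subseteq> A i \<and> P i (restrict_id f (A i)))}"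
  let ?Y = "{f. f permutes A j \<and> P j f}"
  have fin: "finite ?U" "finite (A j)" using insert by auto
  have disj: "A j \<inter> A i = {}" if "i \<in> I" for i
    using disjoint_family_onD[OF insert.prems(2), of j i] insert.hyps(2) that by auto
  then have disjU: "A j \<inter> ?U = {}" by blast
  have "bij_betw (\<lambda>(g, h). g \<circ> h) (?Y \<times> ?X I) (?X (insert j I))"
  proof (rule bij_betw_byWitness[where f' = "\<lambda>f. (restrict_id f (A j), restrict_id f ?U)"])
    have glue: "restrict_id (g \<circ> h) (A j) = g" "restrict_id (g \<circ> h) ?U = h"
      if "g permutes A j" "h permutes ?U" for g h
    proof -
      have h: "h x = x" if "x \<in> A j" for x
        using that disjU \<open>h permutes ?U\<close> by (meson disjoint_iff permutes_not_in)
      have g: "g x = x" if "x \<in> ?U" for x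
        using that disjU \<open>g permutes A j\<close> by (meson disjoint_iff permutes_not_in)
      show "restrict_id (g \<circ> h) (A j) = g"
        using h permutes_not_in[OF that(1)] by (auto simp: fun_eq_iff restrict_id_def)
      show "restrict_id (g \<circ> h) ?U = h"
      proof
        fix x
        show "restrict_id (g \<circ> h) ?U x = h x"
          using g[of "h x"] permutes_in_image[OF that(2), of x] permutes_not_in[OF that(2), of x]
          by (cases "x \<in> ?U") (simp_all add: restrict_id_def)
      qed
    qed
    show "\<forall>a\<in>?Y \<times> ?X I. (restrict_id (case a of (g, h) \<Rightarrow> g \<circ> h) (A j),
        restrict_id (case a of (g, h) \<Rightarrow> g \<circ> h) ?U) = a"
      using glue by auto
    show "(\<lambda>(g, h). g \<circ> h) ` (?Y \<times> ?X I) \<subseteq> ?X (insert j I)"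
    proof
      fix f assume "f \<in> (\<lambda>(g, h). g \<circ> h) ` (?Y \<times> ?X I)"
      then obtain a where "a \<in> ?Y \<times> ?X I" "f = (case a of (g, h) \<Rightarrow> g \<circ> h)"
        by (elim imageE)
      moreover obtain g h where "a = (g, h)" by (cases a)
      ultimately have f: "f = g \<circ> h" and g: "g permutes A j" "P j g" and h: "h permutes ?U"
        "\<forall>i\<in>I. h ` A i \<subseteq> A i \<and> P i (restrict_id h (A i))"
        unfolding mem_Collect_eq by (simp_all only: prod.case mem_Sigma_iff mem_Collect_eq) blast
      have 1: "g \<circ> h permutes A j \<union> ?U"
        using g(1) h(1) by (intro permutes_compose) (auto intro: permutes_subset)
      have hj: "h x = x" if "x \<in> A j" for x
        using that disjU h(1) by (meson disjoint_iff permutes_not_in)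
      have 2: "(g \<circ> h) ` A j \<subseteq> A j" using hj permutes_in_image[OF g(1)] by auto
      have 3: "(g \<circ> h) ` A i \<subseteq> A i \<and> P i (restrict_id (g \<circ> h) (A i))" if i: "i \<in> I" for i
      proof -
        have gh: "g (h x) = h x" if x: "x \<in> A i" for x
        proof -
          have "h x \<in> A i" using h(2) i x by auto
          then show ?thesis using disj[OF i] permutes_not_in[OF g(1)] by blast
        qed
        then have "restrict_id (g \<circ> h) (A i) = restrict_id h (A i)"
          by (auto simp: restrict_id_def fun_eq_iff)
        then show ?thesis using gh h(2) i by auto
      qed
      have 4: "P j (restrict_id (g \<circ> h) (A j))" unfolding glue(1)[OF g(1) h(1)] by (rule g(2))
      show "f \<in> ?X (insert j I)" unfolding f mem_Collect_eq
      proof (intro conjI ballI)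
        show "g \<circ> h permutes \<Union> (A ` insert j I)" using 1 by simp
        fix i assume "i \<in> insert j I"
        then consider "i = j" | "i \<in> I" by blast
        then show "(g \<circ> h) ` A i \<subseteq> A i" "P i (restrict_id (g \<circ> h) (A i))"
          by (cases; use 2 4 3[of i] in blast)+
      qed
    qed
    have split: "f permutes \<Union> (A ` insert j I)" "f ` A j \<subseteq> A j" "\<And>i. i \<in> I \<Longrightarrow> f ` A i \<subseteq> A i"
        "f ` ?U \<subseteq> ?U" if "f \<in> ?X (insert j I)" for f
      using that by (blast, blast, blast, blast)
    show "\<forall>a'\<in>?X (insert j I). (case (restrict_id a' (A j), restrict_id a' ?U) of (g, h) \<Rightarrow> g \<circ> h) = a'"
    proof
      fix f assume f: "f \<in> ?X (insert j I)"
      have "(restrict_id f (A j) \<circ> restrict_id f ?U) x = f x" for x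
      proof (cases "x \<in> ?U")
        case True
        then have "f x \<in> ?U" using split(4)[OF f] by blast
        then have "f x \<notin> A j" using disjU by blast
        then show ?thesis using True by (simp add: restrict_id_def)
      next
        case False
        then show ?thesis using permutes_not_in[OF split(1)[OF f], of x] by (auto simp: restrict_id_def)
      qed
      then show "(case (restrict_id f (A j), restrict_id f ?U) of (g, h) \<Rightarrow> g \<circ> h) = f"
        by (simp add: fun_eq_iff)
    qed
    show "(\<lambda>f. (restrict_id f (A j), restrict_id f ?U)) ` ?X (insert j I) \<subseteq> ?Y \<times> ?X I"
    proof (rule image_subsetI)
      fix f assume f: "f \<in> ?X (insert j I)"
      have 1: "restrict_id f (A j) permutes A j" "restrict_id f ?U permutes ?U"
        using permutes_restrict_id_subset[OF split(1)[OF f]] fin split[OF f] by blast+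
      have 2: "restrict_id (restrict_id f ?U) (A i) = restrict_id f (A i)" if "i \<in> I" for i
        using that by (auto simp: fun_eq_iff restrict_id_def)
      have 3: "restrict_id f ?U ` A i \<subseteq> A i" if "i \<in> I" for i
        using that split(3)[OF f] by (auto simp: restrict_id_def)
      have 4: "P i (restrict_id f (A i))" if "i \<in> insert j I" for i
        using that f by blast
      have "P i (restrict_id (restrict_id f ?U) (A i))" if "i \<in> I" for i
        unfolding 2[OF that] by (rule 4) (use that in blast)
      then show "(restrict_id f (A j), restrict_id f ?U) \<in> ?Y \<times> ?X I"
        using 1 3 4[of j] by blast
    qed
  qed
  from bij_betw_same_card[OF this]
  have "card (?X (insert j I)) = card ?Y * card (?X I)"
    by (simp only: card_cartesian_product)
  also have "card (?X I) = (\<Prod>i\<in>I. card {f. f permutes A i \<and> P i f})"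
    by (rule insert.IH) (use insert.prems in \<open>auto simp: disjoint_family_on_def\<close>)
  finally show ?case using insert.hyps by simp
qed

lemma card_even_half:
  assumes "finite S" and X: "\<And>f. f \<in> X \<Longrightarrow> f permutes S"
    and xy: "x \<noteq> y" "\<And>f. f \<in> X \<Longrightarrow> transpose x y \<circ> f \<in> X"
  shows "card {f \<in> X. evenperm f} = card X div 2"
proof -
  let ?t = "transpose x y"
  have fin: "finite X" by (rule finite_subset[OF _ finite_permutations[OF assms(1)]]) (use X in blast)
  have flip: "evenperm (?t \<circ> f) \<longleftrightarrow> \<not> evenperm f" if "f \<in> X" for f
    using permutes_imp_permutation[OF assms(1) X[OF that]] xy(1)
    by (simp add: evenperm_comp permutation_swap_id evenperm_swap)
  have "bij_betw ((\<circ>) ?t) {f \<in> X. evenperm f} {f \<in> X. \<not> evenperm f}"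
    by (rule bij_betw_byWitness[where f' = "(\<circ>) ?t"])
       (use flip xy in \<open>auto simp: comp_assoc[symmetric]\<close>)
  then have "card {f \<in> X. evenperm f} = card {f \<in> X. \<not> evenperm f}" by (rule bij_betw_same_card)
  moreover have "card X = card {f \<in> X. evenperm f} + card {f \<in> X. \<not> evenperm f}"
    using fin by (subst card_Un_disjoint[symmetric]) (auto intro!: arg_cong[where f = card])
  ultimately show ?thesis by simp
qed

lemma sign_fixed_point_free_order_4:
  assumes "finite M" "f permutes M" "\<And>x. x \<in> M \<Longrightarrow> f (f (f (f x))) = x" "\<And>x. x \<in> M \<Longrightarrow> f (f x) \<noteq> x"
  shows "sign f = (-1) ^ (card M div 4)"
  using assms
proof (induction M arbitrary: f rule: finite_psubset_induct)
  case (psubset M)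
  show ?case
  proof (cases "M = {}")
    case True
    then show ?thesis using psubset.prems(1) by simp
  next
    case False
    then obtain a where a: "a \<in> M" by blast
    define b c d where "b = f a" and "c = f b" and "d = f c"
    let ?C = "{a, b, c, d}"
    have M: "b \<in> M" "c \<in> M" "d \<in> M"
      using a permutes_in_image[OF psubset.prems(1)] by (auto simp: b_def c_def d_def)
    have fd: "f d = a" using psubset.prems(2)[OF a] by (simp add: b_def c_def d_def)
    have ne: "a \<noteq> c" "b \<noteq> d" using psubset.prems(3)[of a] psubset.prems(3)[of b] a M
      by (auto simp: b_def c_def d_def)
    have ne2: "a \<noteq> b" "b \<noteq> c" "c \<noteq> d" "a \<noteq> d"
      using ne fd by (metis b_def c_def d_def)+
    let ?g = "transpose a b \<circ> (transpose b c \<circ> transpose c d)" and ?h = "restrict_id f (M - ?C)"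
    have g: "permutation ?g" "sign ?g = -1"
      using ne2 by (simp_all add: permutation_compose permutation_swap_id sign_compose sign_swap_id)
    have inj: "inj f" using permutes_inj[OF psubset.prems(1)] .
    have sub: "f ` (M - ?C) \<subseteq> M - ?C"
    proof
      fix y assume "y \<in> f ` (M - ?C)"
      then obtain x where x: "y = f x" "x \<in> M" "x \<notin> ?C" by blast
      have "f x \<noteq> f d" "f x \<noteq> f a" "f x \<noteq> f b" "f x \<noteq> f c" using x inj by (auto simp: inj_eq)
      then show "y \<in> M - ?C" using x permutes_in_image[OF psubset.prems(1)] fd
        by (auto simp: b_def c_def d_def)
    qed
    have h: "?h permutes M - ?C"
      by (rule permutes_restrict_id_subset[OF psubset.prems(1) _ sub]) (use psubset.hyps in simp)
    have "f = ?g \<circ> ?h"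
    proof
      fix x
      consider "x = a" | "x = b" | "x = c" | "x = d" | "x \<in> M - ?C" | "x \<notin> M" by blast
      then show "f x = (?g \<circ> ?h) x"
      proof cases
        case 5
        then have "f x \<in> M - ?C" using sub by blast
        then show ?thesis using 5 by (simp add: restrict_id_def)
      next
        case 6
        then have "f x = x" "x \<notin> ?C" using a M permutes_not_in[OF psubset.prems(1)] by auto
        then show ?thesis using 6 by (simp add: restrict_id_def)
      qed (use ne ne2 fd in \<open>simp_all add: restrict_id_def b_def[symmetric] c_def[symmetric] d_def[symmetric]\<close>)
    qed
    then have "sign f = sign (?g \<circ> ?h)" by (rule arg_cong)
    also have "\<dots> = - sign ?h"
      using permutes_imp_permutation[OF _ h] psubset.hyps g by (subst sign_compose) simp_all
    also have "sign ?h = (-1) ^ (card (M - ?C) div 4)"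
    proof (rule psubset.IH[OF _ h])
      show "M - ?C \<subset> M" using a by blast
      fix x assume x: "x \<in> M - ?C"
      then have "f x \<in> M - ?C" "f (f x) \<in> M - ?C" "f (f (f x)) \<in> M - ?C" using sub by blast+
      then show "?h (?h (?h (?h x))) = x" "?h (?h x) \<noteq> x"
        using x psubset.prems(2)[of x] psubset.prems(3)[of x] by (simp_all add: restrict_id_def)
    qed
    also have "card M = card (M - ?C) + 4"
    proof -
      have "card ?C = 4" using ne ne2 by simp
      moreover have "card (M - ?C) = card M - card ?C" using a M by (intro card_Diff_subset) auto
      moreover have "card ?C \<le> card M" using a M psubset.hyps by (intro card_mono) auto
      ultimately show ?thesis by simp
    qed
    then have "- ((-1) ^ (card (M - ?C) div 4)) = ((-1) ^ (card M div 4) :: int)"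

    proof -
      assume "card M = card (M - ?C) + 4"
      then have "card M div 4 = Suc (card (M - ?C) div 4)" by linarith
      then show ?thesis by (simp only: power_Suc mult_minus1)
    qed
    finally show ?thesis .
  qed
qed

section \<open>Words in the moves and rotations of the cube\<close>

lemma m_inv_facelet_sym_group:
  assumes "g permutes facelets n"
  shows "m_inv (facelet_sym_group n) g = inv g"
  using assms
  by (intro group.inv_equality[OF group_facelet_sym_group])
     (simp_all add: facelet_sym_group_def permutes_inv permutes_inv_o)

lemma cube_group_permutes: "g \<in> cube_group n \<Longrightarrow> g permutes facelets n"
  using subgroup.subset[OF subgroup_cube_group] by (auto simp: facelet_sym_group_def)

lemma move_mem_cube_group: "1 \<le> k \<Longrightarrow> k \<le> n div 2 \<Longrightarrow> move n f k \<in> cube_group n"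
  unfolding cube_group_def by (rule generate.incl) (auto simp: cube_moves_def)

interpretation cube_group: perm_group "cube_group n" for n
proof
  show "id \<in> cube_group n"
    using subgroup.one_closed[OF subgroup_cube_group] by (simp add: facelet_sym_group_def)
  show "f \<circ> g \<in> cube_group n" if "f \<in> cube_group n" "g \<in> cube_group n" for f g
    using subgroup.m_closed[OF subgroup_cube_group that] by (simp add: facelet_sym_group_def)
  show "inv f \<in> cube_group n" if "f \<in> cube_group n" for f
    using subgroup.m_inv_closed[OF subgroup_cube_group that]
      m_inv_facelet_sym_group[OF cube_group_permutes[OF that]] by simp
  show "bij f" if "f \<in> cube_group n" for f
    using cube_group_permutes[OF that] permutes_bij by blast
qed

lemma quarter_turn_4: "quarter_turn f (quarter_turn f (quarter_turn f (quarter_turn f p))) = p"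
  by (cases f; cases p) auto

lemma move_4: "move n f k (move n f k (move n f k (move n f k p))) = p"
  by (auto simp: move_def quarter_turn_4 quarter_turn_facelets quarter_turn_slice)

lemma cube_group_induct [consumes 1, case_names id move]:
  assumes g: "g \<in> cube_group n" and id: "P id"
    and step: "\<And>f k g. 1 \<le> k \<Longrightarrow> k \<le> n div 2 \<Longrightarrow> g \<in> cube_group n \<Longrightarrow> P g \<Longrightarrow> P (move n f k \<circ> g)"
  shows "P g"
proof -
  have mem: "m \<circ> h \<in> cube_group n" "P (m \<circ> h)"
    if "m \<in> cube_moves n" "h \<in> cube_group n" "P h" for m h
    using that step move_mem_cube_group cube_group.comp_mem by (auto simp: cube_moves_def)
  have "g \<in> generate (facelet_sym_group n) (cube_moves n) \<Longrightarrow>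
      \<forall>h\<in>cube_group n. P h \<longrightarrow> g \<circ> h \<in> cube_group n \<and> P (g \<circ> h)"
  proof (induction g rule: generate.induct)
    case one
    then show ?case by (simp add: facelet_sym_group_def)
  next
    case (incl m)
    then show ?case using mem by blast
  next
    case (inv m)
    then obtain f k where m: "m = move n f k" by (auto simp: cube_moves_def)
    have "inv m = m \<circ> (m \<circ> m)"
      by (rule inv_unique_comp) (auto simp: m fun_eq_iff move_4)
    then have i: "m_inv (facelet_sym_group n) m = m \<circ> (m \<circ> m)"
      by (simp add: m m_inv_facelet_sym_group move_permutes)
    have "m \<circ> (m \<circ> m) \<circ> h \<in> cube_group n \<and> P (m \<circ> (m \<circ> m) \<circ> h)"
      if "h \<in> cube_group n" "P h" for h
      using mem[OF inv mem[OF inv mem[OF inv that]]] unfolding comp_assoc by blast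
    then show ?case unfolding i by blast
  next
    case (eng h1 h2)
    then show ?case by (simp add: facelet_sym_group_def comp_assoc)
  qed
  then have "P (g \<circ> id)" using g id cube_group.id_mem unfolding cube_group_def by blast
  then show ?thesis by simp
qed

fun rotations :: "facelet \<Rightarrow> facelet list" where
  "rotations (x, y, z) =
    [(x, y, z), (x, - y, - z), (- x, y, - z), (- x, - y, z),
     (y, z, x), (y, - z, - x), (- y, z, - x), (- y, - z, x),
     (z, x, y), (z, - x, - y), (- z, x, - y), (- z, - x, y),
     (- y, - x, - z), (- y, x, z), (y, - x, z), (y, x, - z),
     (- z, - y, - x), (- z, y, x), (z, - y, x), (z, y, - x),
     (- x, - z, - y), (- x, z, y), (x, - z, y), (x, z, - y)]"

definition orb :: "facelet \<Rightarrow> facelet set" where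
  "orb p = set (rotations p)"

lemma finite_orb [simp]: "finite (orb p)"
  by (simp add: orb_def)

lemma self_mem_orb [simp]: "p \<in> orb p"
  by (cases p) (simp add: orb_def)

lemma quarter_turn_mem_orb: "q \<in> orb p \<Longrightarrow> quarter_turn f q \<in> orb p"
  by (cases p; cases f; simp add: orb_def; elim disjE; simp)

lemma orb_mono: "q \<in> orb p \<Longrightarrow> orb q \<subseteq> orb p"
  by (cases p; simp add: orb_def; elim disjE; simp)

lemma orb_sym: "q \<in> orb p \<Longrightarrow> p \<in> orb q"
  by (cases p; simp add: orb_def; elim disjE; simp)

lemma orb_eq: "q \<in> orb p \<Longrightarrow> orb q = orb p"
  using orb_mono orb_sym by blast

lemma cube_group_orb: "g \<in> cube_group n \<Longrightarrow> g p \<in> orb p"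
proof (induction g rule: cube_group_induct)
  case (move f k g)
  then show ?case by (auto simp: move_def quarter_turn_mem_orb)
qed simp

lemma cube_group_image_orb: "g \<in> cube_group n \<Longrightarrow> g ` orb p \<subseteq> orb p"
  using cube_group_orb orb_mono by blast

inductive rotation :: "(facelet \<Rightarrow> facelet) \<Rightarrow> bool" where
  "rotation id"
| "rotation r \<Longrightarrow> rotation (r \<circ> quarter_turn Right)"
| "rotation r \<Longrightarrow> rotation (r \<circ> quarter_turn Back)"

lemma rotation_comp: "rotation s \<Longrightarrow> rotation r \<Longrightarrow> rotation (r \<circ> s)"
  by (induction rule: rotation.induct) (auto simp: comp_assoc[symmetric] intro: rotation.intros)

lemma orb_rotation:
  assumes "q \<in> orb p"
  shows "\<exists>r. rotation r \<and> q = r p"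
proof -
  define Q where "Q = {r p |r. rotation r}"
  have R: "(x, z, - y) \<in> Q" if "(x, y, z) \<in> Q" for x y z
  proof -
    have "rotation (quarter_turn Right)" using rotation.intros(1,2) by fastforce
    then show ?thesis using that rotation_comp unfolding Q_def
      by (smt (verit) comp_apply mem_Collect_eq quarter_turn.simps(5))
  qed
  have B: "(- y, x, z) \<in> Q" if "(x, y, z) \<in> Q" for x y z
  proof -
    have "rotation (quarter_turn Back)" using rotation.intros(1,3) by fastforce
    then show ?thesis using that rotation_comp unfolding Q_def
      by (smt (verit) comp_apply mem_Collect_eq quarter_turn.simps(4))
  qed
  have RR: "(x, - y, - z) \<in> Q" if "(x, y, z) \<in> Q" for x y z using R[OF R[OF that]] .
  have BB: "(- x, - y, z) \<in> Q" if "(x, y, z) \<in> Q" for x y z using B[OF B[OF that]] .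
  have C: "(y, z, x) \<in> Q" if "(x, y, z) \<in> Q" for x y z
    using RR[OF BB[OF R[OF B[OF that]]]] by simp
  have p: "p \<in> Q" unfolding Q_def mem_Collect_eq by (rule exI[of _ id]) (simp add: rotation.intros(1))
  obtain x y z where xyz: "p = (x, y, z)" by (cases p)
  have signs: "{(x, y, z), (x, - y, - z), (- x, y, - z), (- x, - y, z)} \<subseteq> Q" if "(x, y, z) \<in> Q" for x y z
    using that RR[OF that] BB[OF that] RR[OF BB[OF that]] by simp
  note 1 = p[unfolded xyz]
  note 2 = C[OF 1] note 3 = C[OF 2]
  have "orb p \<subseteq> Q"
    using signs[OF 1] signs[OF 2] signs[OF 3] signs[OF B[OF 1]] signs[OF B[OF 2]] signs[OF B[OF 3]]
    unfolding orb_def xyz rotations.simps set_simps by simp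
  then show ?thesis using assms unfolding Q_def by blast
qed

section \<open>Three-cycles of centre facelets\<close>

lemma grid_iff: "x \<in> grid n \<longleftrightarrow> \<bar>x\<bar> < int n \<and> odd (x + int n)"
proof
  assume "\<bar>x\<bar> < int n \<and> odd (x + int n)"
  moreover from this obtain m where "x + int n = 2 * m + 1" by (elim conjE oddE)
  ultimately have "x = 2 * int (nat (m + 1)) - int n - 1" "nat (m + 1) \<in> {1..n}" by auto
  then show "x \<in> grid n" unfolding grid_def by blast
qed (auto simp: grid_def)

lemma facelet_coord:
  assumes "(x, y, z) \<in> facelets n"
  shows "\<bar>x\<bar> = int n \<or> \<bar>x\<bar> < int n \<and> odd (x + int n)"
    and "\<bar>y\<bar> = int n \<or> \<bar>y\<bar> < int n \<and> odd (y + int n)"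
    and "\<bar>z\<bar> = int n \<or> \<bar>z\<bar> < int n \<and> odd (z + int n)"
  using assms by (auto simp: facelets_iff grid_iff)

lemma facelet_coord_near:
  assumes x: "\<bar>x\<bar> = int n \<or> \<bar>x\<bar> < int n \<and> odd (x + int n)"
    and s: "\<bar>s\<bar> < int n - 1" "odd (s + int n)"
  shows "s - 1 \<le> x \<and> x \<le> s + 1 \<longleftrightarrow> x = s"
proof
  assume A: "s - 1 \<le> x \<and> x \<le> s + 1"
  then have "\<bar>x\<bar> \<noteq> int n" using s(1) by linarith
  then have odd: "odd (x + int n)" using x by blast
  from A consider "x = s - 1" | "x = s" | "x = s + 1" by linarith
  then show "x = s" using odd s(2) by cases auto
qed simp

definition normalizes :: "nat \<Rightarrow> (facelet \<Rightarrow> facelet) \<Rightarrow> bool" where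
  "normalizes n h \<longleftrightarrow> bij h \<and> (\<forall>g\<in>cube_group n. \<exists>g'\<in>cube_group n. h \<circ> g = g' \<circ> h)"

lemma normalizes_mem:
  assumes "h \<in> cube_group n"
  shows "normalizes n h"
  unfolding normalizes_def
proof (intro conjI ballI)
  show h: "bij h" using assms cube_group.bij_mem by blast
  fix g assume "g \<in> cube_group n"
  then have "h \<circ> g \<circ> inv h \<in> cube_group n"
    using assms by (intro cube_group.comp_mem cube_group.inv_mem)
  moreover have "h \<circ> g = h \<circ> g \<circ> inv h \<circ> h"
    using h by (simp add: comp_assoc bij_is_inj)
  ultimately show "\<exists>g'\<in>cube_group n. h \<circ> g = g' \<circ> h" by blast
qed

lemma normalizes_comp:
  assumes "normalizes n h" "normalizes n k"
  shows "normalizes n (h \<circ> k)"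
  unfolding normalizes_def
proof (intro conjI ballI)
  show "bij (h \<circ> k)" using assms bij_comp unfolding normalizes_def by blast
  fix g assume "g \<in> cube_group n"
  then obtain g' where g': "g' \<in> cube_group n" "k \<circ> g = g' \<circ> k"
    using assms(2) unfolding normalizes_def by blast
  then obtain g'' where g'': "g'' \<in> cube_group n" "h \<circ> g' = g'' \<circ> h"
    using assms(1) unfolding normalizes_def by blast
  have "h \<circ> k \<circ> g = h \<circ> g' \<circ> k" unfolding comp_assoc g'(2) ..
  also have "\<dots> = g'' \<circ> (h \<circ> k)" unfolding g''(2) comp_assoc ..
  finally show "\<exists>g'\<in>cube_group n. h \<circ> k \<circ> g = g' \<circ> (h \<circ> k)" using g''(1) by blast
qed

lemma bij_quarter_turn: "bij (quarter_turn f)"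
  by (rule o_bij[of "quarter_turn f \<circ> (quarter_turn f \<circ> quarter_turn f)"])
     (auto simp: fun_eq_iff quarter_turn_4)

lemma quarter_turn_move:
  assumes "f \<in> {Right, Back}"
  shows "\<exists>f''. quarter_turn f \<circ> move n f' k = move n f'' k \<circ> quarter_turn f"
proof -
  have *: ?thesis if "\<And>p. height f'' (quarter_turn f p) = height f' p"
    "\<And>p. quarter_turn f'' (quarter_turn f p) = quarter_turn f (quarter_turn f' p)" for f''
    using that by (intro exI[of _ f''])
      (auto simp: fun_eq_iff move_def quarter_turn_facelets slice_def)
  define f'' where "f'' = (if f = Right
      then (case f' of Up \<Rightarrow> Back | Back \<Rightarrow> Down | Down \<Rightarrow> Front | Front \<Rightarrow> Up | h \<Rightarrow> h)
      else (case f' of Right \<Rightarrow> Up | Up \<Rightarrow> Left | Left \<Rightarrow> Down | Down \<Rightarrow> Right | h \<Rightarrow> h))"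
  show ?thesis
  proof (rule *[of f''])
    fix p :: facelet
    show "height f'' (quarter_turn f p) = height f' p"
      "quarter_turn f'' (quarter_turn f p) = quarter_turn f (quarter_turn f' p)"
      using assms by (cases p; cases f'; auto simp: f''_def)+
  qed
qed

lemma normalizes_quarter_turn:
  assumes "f \<in> {Right, Back}"
  shows "normalizes n (quarter_turn f)"
  unfolding normalizes_def
proof (intro conjI ballI)
  fix g assume "g \<in> cube_group n"
  then show "\<exists>g'\<in>cube_group n. quarter_turn f \<circ> g = g' \<circ> quarter_turn f"
  proof (induction g rule: cube_group_induct)
    case id
    show ?case using cube_group.id_mem by (intro bexI[of _ id]) auto
  next
    case (move f' k g)
    then obtain g' where g': "g' \<in> cube_group n" "quarter_turn f \<circ> g = g' \<circ> quarter_turn f" by blast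
    obtain f'' where f'': "quarter_turn f \<circ> move n f' k = move n f'' k \<circ> quarter_turn f"
      using quarter_turn_move[OF assms] by blast
    have "quarter_turn f \<circ> (move n f' k \<circ> g) = move n f'' k \<circ> (quarter_turn f \<circ> g)"
      unfolding comp_assoc[symmetric] f'' ..
    also have "\<dots> = (move n f'' k \<circ> g') \<circ> quarter_turn f" unfolding g'(2) comp_assoc ..
    finally show ?case
      using cube_group.comp_mem[OF move_mem_cube_group[OF move(1,2)] g'(1)] by blast
  qed
qed (rule bij_quarter_turn)

lemma normalizes_rotation: "rotation r \<Longrightarrow> normalizes n r"
proof (induction rule: rotation.induct)
  case 1
  show ?case by (rule normalizes_mem[OF cube_group.id_mem])
qed (simp_all only: normalizes_comp normalizes_quarter_turn insert_iff simp_thms)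

lemma rotation_facelets: "rotation r \<Longrightarrow> r p \<in> facelets n \<longleftrightarrow> p \<in> facelets n"
  by (induction arbitrary: p rule: rotation.induct) (simp_all add: quarter_turn_facelets)

lemma normalizes_cyc3:
  assumes r: "normalizes n r" and mem: "cyc3 a b c \<in> cube_group n" and ne: "a \<noteq> b" "b \<noteq> c" "a \<noteq> c"
  shows "cyc3 (r a) (r b) (r c) \<in> cube_group n"
proof -
  obtain g where g: "g \<in> cube_group n" "r \<circ> cyc3 a b c = g \<circ> r"
    using r mem unfolding normalizes_def by blast
  have "surj r" "inj r" using r unfolding normalizes_def by (simp_all add: bij_def)
  have "cyc3 (r a) (r b) (r c) \<circ> r = g \<circ> r"
    using comp_cyc3[OF \<open>inj r\<close> ne] g(2) by simp
  then have "cyc3 (r a) (r b) (r c) = g"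
    by (intro ext) (metis \<open>surj r\<close> comp_apply surjD)
  then show ?thesis using g by simp
qed

lemma normalizes_commutator_cyc3:
  assumes f: "f \<in> cube_group n" and g: "normalizes n g" and fp: "f p \<noteq> p" "g p \<noteq> p"
    and only: "\<And>q. f q \<noteq> q \<Longrightarrow> g q \<noteq> q \<Longrightarrow> q = p"
  shows "cyc3 p (f p) (g p) \<in> cube_group n" "f p \<noteq> g p"
proof -
  have inj: "inj f" "inj g" using cube_group.bij_mem[OF f] g unfolding normalizes_def by (auto simp: bij_def)
  note comm = commutator_cyc3[OF inj fp only]
  then show "f p \<noteq> g p" by blast
  obtain f' where f': "f' \<in> cube_group n" "g \<circ> f = f' \<circ> g" using f g unfolding normalizes_def by blast
  have "surj g" using g unfolding normalizes_def by (simp add: bij_def)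
  have "f \<circ> g = (cyc3 p (f p) (g p) \<circ> f') \<circ> g" using comm(1) f'(2) by (simp add: comp_assoc)
  then have "f = cyc3 p (f p) (g p) \<circ> f'"
    by (intro ext) (metis \<open>surj g\<close> comp_apply surjD)
  then show "cyc3 p (f p) (g p) \<in> cube_group n"
    using cube_group.comp_mem_cancel_right[OF f'(1), of "cyc3 p (f p) (g p)"] f by simp
qed

lemma move_3:
  "(move n f k \<circ> (move n f k \<circ> move n f k)) p = (if p \<in> facelets n \<and> p \<in> slice n f k
    then quarter_turn f (quarter_turn f (quarter_turn f p)) else p)"
  by (auto simp: move_def quarter_turn_facelets quarter_turn_slice)

lemma move_3_mem:
  "1 \<le> k \<Longrightarrow> k \<le> n div 2 \<Longrightarrow> move n f k \<circ> (move n f k \<circ> move n f k) \<in> cube_group n"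
  by (intro cube_group.comp_mem move_mem_cube_group)

lemma slice_turn_mem:
  assumes s: "\<bar>s\<bar> < int n - 1" "odd (s + int n)" "s \<noteq> 0"
  shows "\<exists>g\<in>cube_group n. \<forall>x y z. (x, y, z) \<in> facelets n \<longrightarrow>
    g (x, y, z) = (if x = s then (x, z, - y) else (x, y, z))"
proof -
  from s(2) obtain m where m: "s + int n = 2 * m + 1" by (elim oddE)
  show ?thesis
  proof (cases "s > 0")
    case True
    define k where "k = nat (int n - m)"
    have k: "1 \<le> k" "k \<le> n div 2" "int k = int n - m" using True s m by (auto simp: k_def)
    have "move n Right k (x, y, z) = (if x = s then (x, z, - y) else (x, y, z))"
      if "(x, y, z) \<in> facelets n" for x y z
    proof -
      have "(x, y, z) \<in> slice n Right k \<longleftrightarrow> s - 1 \<le> x \<and> x \<le> s + 1"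
        using k m by (auto simp: slice_def)
      also have "\<dots> \<longleftrightarrow> x = s"
        by (rule facelet_coord_near[OF facelet_coord(1)[OF that] s(1,2)])
      finally show ?thesis using that by (simp add: move_def)
    qed
    then show ?thesis using move_mem_cube_group k by blast
  next
    case False
    define k where "k = nat (m + 1)"
    have k: "1 \<le> k" "k \<le> n div 2" "int k = m + 1" using False s m by (auto simp: k_def)
    let ?g = "move n Left k \<circ> (move n Left k \<circ> move n Left k)"
    have "?g (x, y, z) = (if x = s then (x, z, - y) else (x, y, z))"
      if "(x, y, z) \<in> facelets n" for x y z
    proof -
      have "(x, y, z) \<in> slice n Left k \<longleftrightarrow> s - 1 \<le> x \<and> x \<le> s + 1"
        using k m by (auto simp: slice_def)
      also have "\<dots> \<longleftrightarrow> x = s"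
        by (rule facelet_coord_near[OF facelet_coord(1)[OF that] s(1,2)])
      finally show ?thesis using that unfolding move_3 by simp
    qed
    then show ?thesis using move_3_mem k by blast
  qed
qed

lemma outer_slices_turn_mem:
  assumes "m \<le> n div 2"
  shows "\<exists>g\<in>cube_group n. \<forall>x y z. (x, y, z) \<in> facelets n \<longrightarrow>
    g (x, y, z) = (if \<bar>x\<bar> > int n - 2 * int m then (x, z, - y) else (x, y, z))"
  using assms
proof (induction m)
  case 0
  have "\<not> \<bar>x\<bar> > int n" if "(x, y, z) \<in> facelets n" for x y z
    using facelet_coord(1)[OF that] by auto
  then show ?case using cube_group.id_mem by (intro bexI[of _ id]) auto
next
  case (Suc m)
  then obtain g where g: "g \<in> cube_group n" "\<And>x y z. (x, y, z) \<in> facelets n \<Longrightarrow>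
    g (x, y, z) = (if \<bar>x\<bar> > int n - 2 * int m then (x, z, - y) else (x, y, z))" by auto
  let ?L = "move n Left (Suc m) \<circ> (move n Left (Suc m) \<circ> move n Left (Suc m))"
  let ?R = "move n Right (Suc m)"
  have "(g \<circ> (?R \<circ> ?L)) (x, y, z) = (if \<bar>x\<bar> > int n - 2 * int (Suc m) then (x, z, - y) else (x, y, z))"
    if p: "(x, y, z) \<in> facelets n" for x y z
  proof -
    have p': "(x, z, - y) \<in> facelets n" using p by (auto simp: facelets_iff)
    have c: "\<bar>x\<bar> = int n \<or> \<bar>x\<bar> < int n \<and> odd (x + int n)" using facelet_coord(1)[OF p] .
    define d where "d = int n - 2 * int (Suc m)"
    have d: "d \<ge> 0" "d < int n" "even (d + int n)" using Suc.prems by (auto simp: d_def)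
    have nd: "\<bar>x\<bar> \<noteq> d"
    proof
      assume "\<bar>x\<bar> = d"
      then have "even (x + int n)" using d(3) by (cases "x \<ge> 0") auto
      then show False using c \<open>\<bar>x\<bar> = d\<close> d(2) by auto
    qed
    have L: "(x, y', z') \<in> slice n Left (Suc m) \<longleftrightarrow> d \<le> - x \<and> - x \<le> d + 2"
      and R: "(x, y', z') \<in> slice n Right (Suc m) \<longleftrightarrow> d \<le> x \<and> x \<le> d + 2" for y' z'
      by (auto simp: slice_def d_def)
    have nn: "d + 2 \<le> int n" "int n - 2 * int m = d + 2" by (auto simp: d_def)
    have Lp: "?L (x, y, z) = (if d \<le> - x \<and> - x \<le> d + 2 then (x, z, - y) else (x, y, z))"
      unfolding move_3 L using p by simp
    have Rp: "?R (x, y', z') = (if d \<le> x \<and> x \<le> d + 2 then (x, z', - y') else (x, y', z'))"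
      if "(x, y', z') \<in> facelets n" for y' z'
      using that by (simp add: move_def R)
    have g1: "g (x, y', z') = (if \<bar>x\<bar> > d + 2 then (x, z', - y') else (x, y', z'))"
      if "(x, y', z') \<in> facelets n" for y' z'
      using g(2)[OF that] by (simp add: nn)
    consider "d < - x" "- x \<le> d + 2" | "d < x" "x \<le> d + 2" | "\<bar>x\<bar> > d + 2" | "\<bar>x\<bar> < d"
      using nd by linarith
    then have "(g \<circ> (?R \<circ> ?L)) (x, y, z) = (if \<bar>x\<bar> > d then (x, z, - y) else (x, y, z))"
    proof cases
      case 1
      then have x: "\<not> d \<le> x" "\<not> \<bar>x\<bar> > d + 2" "\<bar>x\<bar> > d" using d(1) by linarith+
      have "?L (x, y, z) = (x, z, - y)" using 1 Lp by simp
      moreover have "?R (x, z, - y) = (x, z, - y)" using x Rp[OF p'] by simp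
      moreover have "g (x, z, - y) = (x, z, - y)" using x g1[OF p'] by simp
      ultimately show ?thesis using x(3) by (simp only: comp_apply if_True)
    next
      case 2
      then have x: "\<not> d \<le> - x" "\<not> \<bar>x\<bar> > d + 2" "\<bar>x\<bar> > d" using d(1) by linarith+
      have "?L (x, y, z) = (x, y, z)" using x(1) Lp by simp
      moreover have "?R (x, y, z) = (x, z, - y)" using 2 Rp[OF p] by simp
      moreover have "g (x, z, - y) = (x, z, - y)" using x g1[OF p'] by simp
      ultimately show ?thesis using x(3) by (simp only: comp_apply if_True)
    next
      case 3
      then have x: "\<not> (d \<le> - x \<and> - x \<le> d + 2)" "\<not> (d \<le> x \<and> x \<le> d + 2)" "\<bar>x\<bar> > d"
        using d(1) by linarith+
      have "?L (x, y, z) = (x, y, z)" using x(1) Lp by (simp only: if_False)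
      moreover have "?R (x, y, z) = (x, y, z)" using x(2) Rp[OF p] by (simp only: if_False)
      moreover have "g (x, y, z) = (x, z, - y)" using 3 g1[OF p] by simp
      ultimately show ?thesis using x(3) by (simp only: comp_apply if_True)
    next
      case 4
      then have x: "\<not> d \<le> - x" "\<not> d \<le> x" "\<not> \<bar>x\<bar> > d" "\<not> \<bar>x\<bar> > d + 2"
        using d(1) by linarith+
      have "?L (x, y, z) = (x, y, z)" using x(1) Lp by simp
      moreover have "?R (x, y, z) = (x, y, z)" using x(2) Rp[OF p] by simp
      moreover have "g (x, y, z) = (x, y, z)" using x g1[OF p] by simp
      ultimately show ?thesis using x(3) by (simp only: comp_apply if_False)
    qed
    then show ?thesis by (simp add: d_def)
  qed
  moreover have "g \<circ> (?R \<circ> ?L) \<in> cube_group n"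
    using Suc.prems by (intro cube_group.comp_mem g(1) move_mem_cube_group) auto
  ultimately show ?case by blast
qed

text \<open>
  For odd \<open>n\<close> the turn of the middle slice is not a move, but it is a rotation of the whole cube
  combined with turns of all parallel slices, hence it still normalizes the group. This suffices for
  commutators and is what makes the case \<open>b = 0\<close> work.
\<close>

lemma slice_turn_normalizes:
  assumes s: "\<bar>s\<bar> < int n - 1" "odd (s + int n)"
  shows "\<exists>g. normalizes n g \<and> (\<forall>x y z. (x, y, z) \<in> facelets n \<longrightarrow>
    g (x, y, z) = (if x = s then (x, z, - y) else (x, y, z)))"
proof (cases "s = 0")
  case False
  then show ?thesis using slice_turn_mem[OF s] normalizes_mem by blast
next
  case True
  obtain t where t: "t \<in> cube_group n" "\<And>x y z. (x, y, z) \<in> facelets n \<Longrightarrow>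
    t (x, y, z) = (if \<bar>x\<bar> > int n - 2 * int (n div 2) then (x, z, - y) else (x, y, z))"
    using outer_slices_turn_mem[of "n div 2" n] by auto
  have n: "int n - 2 * int (n div 2) = 1"
  proof -
    have "odd n" using s(2) True by simp
    then show ?thesis by presburger
  qed
  have tt: "t (x, y, z) = (if x = 0 then (x, y, z) else (x, z, - y))"
    if p: "(x, y, z) \<in> facelets n" for x y z
  proof -
    have "x \<noteq> 1" "x \<noteq> - 1" using facelet_coord(1)[OF p] s True by auto
    then have "\<bar>x\<bar> > 1 \<longleftrightarrow> x \<noteq> 0" by auto
    then show ?thesis using t(2)[OF p] by (simp add: n)
  qed
  let ?g = "quarter_turn Right \<circ> (t \<circ> (t \<circ> t))"
  have "?g (x, y, z) = (if x = s then (x, z, - y) else (x, y, z))"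
    if p: "(x, y, z) \<in> facelets n" for x y z
  proof -
    have p': "(x, z, - y) \<in> facelets n" "(x, - y, - z) \<in> facelets n"
      using p by (auto simp: facelets_iff)
    show ?thesis using tt[OF p] tt[OF p'(1)] tt[OF p'(2)] True by auto
  qed
  moreover have "normalizes n ?g"
    by (intro normalizes_comp normalizes_quarter_turn normalizes_mem t(1)) simp
  ultimately show ?thesis by blast
qed

lemma centre_cyc3:
  assumes a: "\<bar>a\<bar> < int n - 1" "odd (a + int n)" "a \<noteq> 0"
    and b: "\<bar>b\<bar> < int n - 1" "odd (b + int n)" "a \<noteq> - b"
  shows "cyc3 (a, b, int n) (a, int n, - b) (- b, int n, - a) \<in> cube_group n"
proof -
  obtain f where f: "f \<in> cube_group n" "\<And>x y z. (x, y, z) \<in> facelets n \<Longrightarrow>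
      f (x, y, z) = (if x = a then (x, z, - y) else (x, y, z))"
    using slice_turn_mem[OF a] by blast
  have b': "\<bar>- b\<bar> < int n - 1" "odd (- b + int n)" using b by auto
  obtain h where h: "normalizes n h" "\<And>x y z. (x, y, z) \<in> facelets n \<Longrightarrow>
      h (x, y, z) = (if x = - b then (x, z, - y) else (x, y, z))"
    using slice_turn_normalizes[OF b'] by blast
  let ?F = "move n Front 1"
  let ?F' = "?F \<circ> (?F \<circ> ?F)"
  let ?g = "?F \<circ> (h \<circ> ?F')"
  have n: "1 \<le> n div 2" using a by auto
  have g: "normalizes n ?g"
    by (intro normalizes_comp h(1) normalizes_mem cube_group.comp_mem move_mem_cube_group n) simp_all
  have F': "?F' (x, y, z) = (if z \<ge> int n - 2 then (- y, x, z) else (x, y, z))"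
    if p: "(x, y, z) \<in> facelets n" for x y z
  proof -
    have "z \<le> int n" using facelet_coord(3)[OF p] by auto
    then have "(x, y, z) \<in> slice n Front 1 \<longleftrightarrow> z \<ge> int n - 2" by (auto simp: slice_def)
    then show ?thesis using p unfolding move_3 by simp
  qed
  have F: "?F (x, y, z) = (if z \<ge> int n - 2 then (y, - x, z) else (x, y, z))"
    if p: "(x, y, z) \<in> facelets n" for x y z
  proof -
    have "z \<le> int n" using facelet_coord(3)[OF p] by auto
    then have "(x, y, z) \<in> slice n Front 1 \<longleftrightarrow> z \<ge> int n - 2" by (auto simp: slice_def)
    then show ?thesis using p by (simp add: move_def)
  qed
  have grid: "a \<in> grid n" "b \<in> grid n" using a b by (auto simp: grid_iff)
  have p0: "(a, b, int n) \<in> facelets n" "(- b, a, int n) \<in> facelets n" "(- b, int n, - a) \<in> facelets n"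
    using grid by (auto simp: facelets_iff)
  have a': "- a < int n - 2"
  proof -
    have "- a \<noteq> int n - 2"
    proof
      assume "- a = int n - 2"
      then have "a + int n = 2" by simp
      then show False using a(2) by simp
    qed
    then show ?thesis using a(1) by linarith
  qed
  have fp: "f (a, b, int n) = (a, int n, - b)" using f(2)[OF p0(1)] by simp
  have gp: "?g (a, b, int n) = (- b, int n, - a)"
    unfolding comp_apply using F'[OF p0(1)] h(2)[OF p0(2)] F[OF p0(3)] a' by (simp add: comp_def)
  have "cyc3 (a, b, int n) (f (a, b, int n)) (?g (a, b, int n)) \<in> cube_group n"
  proof (rule normalizes_commutator_cyc3(1)[OF f(1) g])
    show "f (a, b, int n) \<noteq> (a, b, int n)" "?g (a, b, int n) \<noteq> (a, b, int n)"
      unfolding fp gp using b by auto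
    fix q assume q: "f q \<noteq> q" "?g q \<noteq> q"
    obtain x y z where xyz: "q = (x, y, z)" by (cases q)
    have fac: "(x, y, z) \<in> facelets n"
      using q(1) permutes_not_in[OF cube_group_permutes[OF f(1)]] xyz by blast
    have x: "x = a" using f(2)[OF fac] q(1) xyz by (auto split: if_splits)
    show "q = (a, b, int n)"
    proof (cases "z \<ge> int n - 2 \<and> y = b")
      case True
      then have "z = int n" using fac a(1) b(1) x by (auto simp: facelets_iff)
      then show ?thesis using True x xyz by simp
    next
      case False
      have fac': "(- y, x, z) \<in> facelets n" using fac by (auto simp: facelets_iff)
      have "?g q = q"
      proof (cases "z \<ge> int n - 2")
        case True
        then have "?F' q = (- y, x, z)" using F'[OF fac] xyz by simp
        moreover have "h (- y, x, z) = (- y, x, z)" using h(2)[OF fac'] True False by simp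
        moreover have "?F (- y, x, z) = q" using F[OF fac'] True xyz by simp
        ultimately show ?thesis by simp
      next
        case z: False
        then have "?F' q = q" "?F q = q" using F'[OF fac] F[OF fac] xyz by simp_all
        moreover have "h q = q" using h(2)[OF fac] x b(3) xyz by simp
        ultimately show ?thesis by simp
      qed
      then show ?thesis using q(2) by contradiction
    qed
  qed
  then show ?thesis unfolding fp gp .
qed

lemma contains_alt_orb_rep:
  assumes a: "\<bar>a\<bar> < int n - 1" "odd (a + int n)" "a \<noteq> 0"
    and b: "\<bar>b\<bar> < int n - 1" "odd (b + int n)" "a \<noteq> - b"
  shows "cube_group.contains_alt n (orb (a, b, int n))"
proof -
  define p where "p = (a, b, int n)"
  define p1 where "p1 = (a, int n, - b)"
  define p2 where "p2 = (- b, int n, - a)"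
  have ne: "p \<noteq> p1" "p1 \<noteq> p2" "p \<noteq> p2" using a b by (auto simp: p_def p1_def p2_def)
  have mem: "cyc3 p p1 p2 \<in> cube_group n" using centre_cyc3[OF a b] by (simp add: p_def p1_def p2_def)
  have fac: "p \<in> facelets n" "p1 \<in> facelets n" "p2 \<in> facelets n"
    using a b by (auto simp: facelets_iff grid_iff p_def p1_def p2_def)
  define \<S> where "\<S> = {S. S \<subseteq> facelets n \<and> {p, p1, p2} \<subseteq> S \<and> cube_group.contains_alt n S}"
  have "finite \<S>" using finite_facelets by (simp add: \<S>_def)
  moreover have "{p, p1, p2} \<in> \<S>"
    using fac cube_group.contains_alt_triple[OF mem ne] by (simp add: \<S>_def)
  ultimately obtain S where S': "S \<in> \<S>" and max: "\<And>T. T \<in> \<S> \<Longrightarrow> S \<subseteq> T \<Longrightarrow> S = T"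
    using finite_has_maximal2[of \<S>] by metis
  have S: "S \<subseteq> facelets n" "{p, p1, p2} \<subseteq> S" "cube_group.contains_alt n S"
    using S' unfolding \<S>_def by blast+
  have finS: "finite S" using S finite_subset finite_facelets by blast
  have "card {p, p1, p2} = 3" using ne by simp
  then have cardS: "card S \<ge> 3" using S card_mono[OF finS, of "{p, p1, p2}"] by simp
  have absorb: "{x, y, z} \<subseteq> S" if "cyc3 x y z \<in> cube_group n" "x \<noteq> y" "y \<noteq> z" "x \<noteq> z" "x \<in> S"
    "{x, y, z} \<subseteq> facelets n" for x y z
  proof -
    have "cube_group.contains_alt n (S \<union> {x, y, z})"
      by (rule cube_group.contains_alt_Un[OF finS cardS S(3) that(1-5)])
    then have "S \<union> {x, y, z} \<in> \<S>" using S that unfolding \<S>_def by blast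
    from max[OF this] show ?thesis by blast
  qed
  have triple: "{r p, r p1, r p2} \<subseteq> S" if r: "rotation r" and "r p \<in> S \<or> r p1 \<in> S" for r
  proof -
    have "inj r" using normalizes_rotation[OF r, of n] unfolding normalizes_def by (simp add: bij_def)
    then have rne: "r p \<noteq> r p1" "r p1 \<noteq> r p2" "r p \<noteq> r p2" using ne by (simp_all add: inj_eq)
    have c: "cyc3 (r p) (r p1) (r p2) \<in> cube_group n"
      by (rule normalizes_cyc3[OF normalizes_rotation[OF r] mem ne])
    have rf: "{r p, r p1, r p2} \<subseteq> facelets n" using fac rotation_facelets[OF r] by simp
    from that(2) show ?thesis
    proof
      assume "r p \<in> S"
      then show ?thesis using absorb[OF c rne] rf by blast
    next
      assume "r p1 \<in> S"
      have "cyc3 (r p1) (r p2) (r p) \<in> cube_group n" using c unfolding cyc3_rotate[OF rne] .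
      from absorb[OF this rne(2) rne(3)[symmetric] rne(1)[symmetric] \<open>r p1 \<in> S\<close>]
      show ?thesis using rf by blast
    qed
  qed
  have "r p \<in> S" if "rotation r" for r
    using that
  proof (induction r rule: rotation.induct)
    case 1
    then show ?case using S by simp
  next
    case (2 r)
    then have "r p1 \<in> S" using triple by blast
    then show ?case by (simp add: p_def p1_def)
  next
    case (3 r)
    let ?r = "r \<circ> quarter_turn Right \<circ> quarter_turn Right \<circ> quarter_turn Right"
    have "rotation ?r" using 3(1) by (intro rotation.intros)
    moreover have "?r p1 \<in> S" using 3(2) by (simp add: p_def p1_def)
    ultimately have "?r p2 \<in> S" using triple by blast
    then show ?case by (simp add: p_def p2_def)
  qed
  then have "orb p \<subseteq> S" using orb_rotation by blast
  then show ?thesis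
    using S(3) permutes_subset[of _ "orb p" S] unfolding p_def cube_group.contains_alt_def by simp
qed

section \<open>Parity\<close>

text \<open>\<open>cubie\<close> sends a facelet to the midpoint of the small cube carrying it.\<close>

definition clamp :: "nat \<Rightarrow> int \<Rightarrow> int" where
  "clamp n x = max (1 - int n) (min (int n - 1) x)"

fun cubie :: "nat \<Rightarrow> facelet \<Rightarrow> facelet" where
  "cubie n (x, y, z) = (clamp n x, clamp n y, clamp n z)"

lemma clamp_uminus [simp]: "n \<ge> 1 \<Longrightarrow> clamp n (- x) = - clamp n x"
  by (auto simp: clamp_def max_def min_def)

lemma height_cubie: "n \<ge> 1 \<Longrightarrow> height f (cubie n p) = clamp n (height f p)"
  by (cases p; cases f) auto

lemma quarter_turn_cubie: "n \<ge> 1 \<Longrightarrow> cubie n (quarter_turn f p) = quarter_turn f (cubie n p)"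
  by (cases p; cases f) auto

lemma height_bounds: "p \<in> facelets n \<Longrightarrow> \<bar>height f p\<bar> \<le> int n"
  by (cases p; cases f) (auto dest: facelet_coord)

lemma slice_cubie:
  assumes "p \<in> facelets n" "1 \<le> k" "k \<le> n div 2"
  shows "cubie n p \<in> slice n f k \<longleftrightarrow> p \<in> slice n f k"
proof -
  have n: "2 * int k \<le> int n" "n \<ge> 1" using assms by auto
  show ?thesis
  proof (cases "k = 1")
    case True
    then show ?thesis using height_bounds[OF assms(1), of f] n
      by (auto simp: slice_def height_cubie clamp_def max_def min_def)
  next
    case False
    then have "int k \<ge> 2" using assms(2) by simp
    then show ?thesis using height_bounds[OF assms(1), of f] n
      by (auto simp: slice_def height_cubie clamp_def max_def min_def)
  qed
qed

lemma cube_group_mem_facelets: "g \<in> cube_group n \<Longrightarrow> g p \<in> facelets n \<longleftrightarrow> p \<in> facelets n"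
  using permutes_in_image[OF cube_group_permutes] by blast

lemma cube_group_cubie:
  assumes "g \<in> cube_group n" "p \<in> facelets n" "q \<in> facelets n" "cubie n p = cubie n q"
  shows "cubie n (g p) = cubie n (g q)"
  using assms(1)
proof (induction g rule: cube_group_induct)
  case id
  then show ?case using assms by simp
next
  case (move f k g)
  have n: "n \<ge> 1" using move by auto
  have fac: "g p \<in> facelets n" "g q \<in> facelets n"
    using assms move cube_group_mem_facelets by auto
  have "g p \<in> slice n f k \<longleftrightarrow> g q \<in> slice n f k"
    using slice_cubie[OF fac(1)] slice_cubie[OF fac(2)] move by metis
  then show ?case using move fac quarter_turn_cubie[OF n] by (simp add: move_def)
qed

lemma height_face_facelets: "p \<in> face_facelets n f \<Longrightarrow> height f p = int n"
  by (cases p; cases f) auto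

lemma clamp_in_grid:
  assumes "n \<ge> 1" "\<bar>x\<bar> = int n \<or> \<bar>x\<bar> < int n \<and> odd (x + int n)"
  shows "clamp n x \<in> grid n"
proof -
  have "clamp n x = x \<and> \<bar>x\<bar> < int n \<or> \<bar>clamp n x\<bar> = int n - 1"
    using assms by (auto simp: clamp_def)
  then show ?thesis
  proof
    assume "\<bar>clamp n x\<bar> = int n - 1"
    then consider "clamp n x = int n - 1" | "clamp n x = - (int n - 1)" by linarith
    then show ?thesis using assms(1) by cases (simp_all add: grid_iff)
  qed (use assms in \<open>auto simp: grid_iff\<close>)
qed

lemma clamp_clamp: "clamp n (clamp n x) = clamp n x"
  by (auto simp: clamp_def)

lemma ex_face_facelet_same_cubie:
  assumes "p \<in> facelets n" "n \<ge> 1" "height f p \<ge> int n - 1"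
  shows "\<exists>q \<in> face_facelets n f. cubie n q = cubie n p"
proof -
  obtain x y z where p: "p = (x, y, z)" by (cases p)
  have g: "clamp n x \<in> grid n" "clamp n y \<in> grid n" "clamp n z \<in> grid n"
    using facelet_coord[OF assms(1)[unfolded p]] assms(2) by (auto intro: clamp_in_grid)
  have c: "clamp n w = clamp n (int n)" if "w \<ge> int n - 1" for w
    using that assms(2) by (auto simp: clamp_def)
  have c': "clamp n w = clamp n (- int n)" if "- w \<ge> int n - 1" for w
    using that assms(2) by (auto simp: clamp_def)
  show ?thesis
  proof (cases f)
    case Up
    then show ?thesis using assms g c[of y] p
      by (intro bexI[of _ "(clamp n x, int n, clamp n z)"]) (auto simp: clamp_clamp)
  next
    case Down
    then show ?thesis using assms g c'[of y] p
      by (intro bexI[of _ "(clamp n x, - int n, clamp n z)"]) (auto simp: clamp_clamp)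
  next
    case Front
    then show ?thesis using assms g c[of z] p
      by (intro bexI[of _ "(clamp n x, clamp n y, int n)"]) (auto simp: clamp_clamp)
  next
    case Back
    then show ?thesis using assms g c'[of z] p
      by (intro bexI[of _ "(clamp n x, clamp n y, - int n)"]) (auto simp: clamp_clamp)
  next
    case Right
    then show ?thesis using assms g c[of x] p
      by (intro bexI[of _ "(int n, clamp n y, clamp n z)"]) (auto simp: clamp_clamp)
  next
    case Left
    then show ?thesis using assms g c'[of x] p
      by (intro bexI[of _ "(- int n, clamp n y, clamp n z)"]) (auto simp: clamp_clamp)
  qed
qed

lemma face_preserving_height:
  assumes g: "g \<in> cube_group n" "\<And>p f. p \<in> face_facelets n f \<Longrightarrow> g p \<in> face_facelets n f"
    and p: "p \<in> facelets n" "n \<ge> 2" "height f p \<ge> int n - 1"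
  shows "height f (g p) \<ge> int n - 1"
proof -
  have n: "n \<ge> 1" using p(2) by simp
  obtain q where q: "q \<in> face_facelets n f" "cubie n q = cubie n p"
    using ex_face_facelet_same_cubie[OF p(1) n p(3)] by blast
  have "q \<in> facelets n" using q(1) unfolding facelets_def by blast
  then have "cubie n (g q) = cubie n (g p)" using cube_group_cubie[OF g(1) _ p(1)] q(2) by blast
  then have "clamp n (height f (g q)) = clamp n (height f (g p))"
    using height_cubie[OF n] by metis
  then have "clamp n (height f (g p)) = clamp n (int n)"
    using height_face_facelets[OF g(2)[OF q(1)]] by simp
  then show ?thesis using p(2) by (auto simp: clamp_def max_def min_def split: if_splits)
qed

definition inner :: "nat \<Rightarrow> facelet set" where
  "inner n = {(x, y, z) \<in> facelets n. \<bar>x\<bar> \<noteq> int n - 1 \<and> \<bar>y\<bar> \<noteq> int n - 1 \<and> \<bar>z\<bar> \<noteq> int n - 1 \<and>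
    \<not> (x = 0 \<and> y = 0) \<and> \<not> (x = 0 \<and> z = 0) \<and> \<not> (y = 0 \<and> z = 0)}"

lemma orb_cycle: "(x', y', z') \<in> orb (x, y, z) \<Longrightarrow> (y', z', x') \<in> orb (y, z, x)"
  by (simp add: orb_def; elim disjE; simp)

lemma orb_rigid:
  fixes N :: int
  assumes orb: "(x', y', z') \<in> orb (x, y, z)"
    and "\<bar>x\<bar> = N + 1 \<and> \<bar>y\<bar> \<le> N \<and> \<bar>z\<bar> \<le> N \<and> (\<bar>y\<bar> = N \<or> \<bar>z\<bar> = N)"
    and "N > 0"
    and "x \<ge> N \<Longrightarrow> x' \<ge> N" "- x \<ge> N \<Longrightarrow> - x' \<ge> N" "y \<ge> N \<Longrightarrow> y' \<ge> N" "- y \<ge> N \<Longrightarrow> - y' \<ge> N"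
      "z \<ge> N \<Longrightarrow> z' \<ge> N" "- z \<ge> N \<Longrightarrow> - z' \<ge> N"
    and "\<bar>x'\<bar> = N + 1"
  shows "(x', y', z') = (x, y, z)"
proof -
  have "x' = x" using assms(2-5,10) by linarith
  have "y' = y \<and> z' = z \<or> y' = - z \<and> z' = y \<or> y' = - y \<and> z' = - z \<or> y' = z \<and> z' = - y"
    using orb \<open>x' = x\<close> assms(2,3) unfolding orb_def rotations.simps set_simps insert_iff empty_iff prod.inject
    by (elim disjE conjE; (blast | linarith))
  then have "y' = y \<and> z' = z"
  proof (elim disjE)
    assume "y' = - z \<and> z' = y" then show ?thesis using assms(2,3,6-9) by (smt (verit))
  next
    assume "y' = - y \<and> z' = - z" then show ?thesis using assms(2,3,6-9) by (smt (verit))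
  next
    assume "y' = z \<and> z' = - y" then show ?thesis using assms(2,3,6-9) by (smt (verit))
  qed
  then show ?thesis using \<open>x' = x\<close> by simp
qed

lemma face_preserving_fixes:
  assumes g: "g \<in> cube_group n" "\<And>p f. p \<in> face_facelets n f \<Longrightarrow> g p \<in> face_facelets n f"
    and n: "n \<ge> 2" and p: "(x, y, z) \<in> facelets n"
    and b: "\<bar>x\<bar> = int n - 1 \<or> \<bar>y\<bar> = int n - 1 \<or> \<bar>z\<bar> = int n - 1"
  shows "g (x, y, z) = (x, y, z)"
proof -
  obtain x' y' z' where xyz: "g (x, y, z) = (x', y', z')" by (cases "g (x, y, z)")
  have orb: "(x', y', z') \<in> orb (x, y, z)" using cube_group_orb[OF g(1)] xyz by metis
  have H: "height f (x, y, z) \<ge> int n - 1 \<Longrightarrow> height f (x', y', z') \<ge> int n - 1" for f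
    using face_preserving_height[OF g p] n xyz by simp
  have h: "x \<ge> int n - 1 \<Longrightarrow> x' \<ge> int n - 1" "- x \<ge> int n - 1 \<Longrightarrow> - x' \<ge> int n - 1"
    "y \<ge> int n - 1 \<Longrightarrow> y' \<ge> int n - 1" "- y \<ge> int n - 1 \<Longrightarrow> - y' \<ge> int n - 1"
    "z \<ge> int n - 1 \<Longrightarrow> z' \<ge> int n - 1" "- z \<ge> int n - 1 \<Longrightarrow> - z' \<ge> int n - 1"
    using H[of Right] H[of Left] H[of Up] H[of Down] H[of Front] H[of Back] by simp_all
  have face: "(x', y', z') \<in> face_facelets n f" if "(x, y, z) \<in> face_facelets n f" for f
    using g(2)[OF that] xyz by simp
  obtain f where f: "(x, y, z) \<in> face_facelets n f" using p unfolding facelets_def by blast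
  have cyc: "(y', z', x') \<in> orb (y, z, x)" "(z', x', y') \<in> orb (z, x, y)"
    using orb_cycle[OF orb] orb_cycle[OF orb_cycle[OF orb]] .
  have N: "int n - 1 > 0" using n by simp
  have gb: "\<bar>w\<bar> \<le> int n - 1" if "w \<in> grid n" for w using grid_bounds[OF that] by linarith
  have ax: "\<bar>x\<bar> = int n \<and> \<bar>x'\<bar> = int n \<and> \<bar>y\<bar> \<le> int n - 1 \<and> \<bar>z\<bar> \<le> int n - 1 \<or>
    \<bar>y\<bar> = int n \<and> \<bar>y'\<bar> = int n \<and> \<bar>z\<bar> \<le> int n - 1 \<and> \<bar>x\<bar> \<le> int n - 1 \<or>
    \<bar>z\<bar> = int n \<and> \<bar>z'\<bar> = int n \<and> \<bar>x\<bar> \<le> int n - 1 \<and> \<bar>y\<bar> \<le> int n - 1"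
    using f face[OF f] gb by (cases f) auto
  then consider
      "\<bar>x\<bar> = int n - 1 + 1 \<and> \<bar>y\<bar> \<le> int n - 1 \<and> \<bar>z\<bar> \<le> int n - 1 \<and> (\<bar>y\<bar> = int n - 1 \<or> \<bar>z\<bar> = int n - 1)" "\<bar>x'\<bar> = int n - 1 + 1"
    | "\<bar>y\<bar> = int n - 1 + 1 \<and> \<bar>z\<bar> \<le> int n - 1 \<and> \<bar>x\<bar> \<le> int n - 1 \<and> (\<bar>z\<bar> = int n - 1 \<or> \<bar>x\<bar> = int n - 1)" "\<bar>y'\<bar> = int n - 1 + 1"
    | "\<bar>z\<bar> = int n - 1 + 1 \<and> \<bar>x\<bar> \<le> int n - 1 \<and> \<bar>y\<bar> \<le> int n - 1 \<and> (\<bar>x\<bar> = int n - 1 \<or> \<bar>y\<bar> = int n - 1)" "\<bar>z'\<bar> = int n - 1 + 1"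
    using b by auto
  then have "(x', y', z') = (x, y, z)"
  proof cases
    case 1
    show ?thesis by (rule orb_rigid[OF orb 1(1) N h(1-6) 1(2)])
  next
    case 2
    have "(y', z', x') = (y, z, x)" by (rule orb_rigid[OF cyc(1) 2(1) N h(3-6) h(1,2) 2(2)])
    then show ?thesis by simp
  next
    case 3
    have "(z', x', y') = (z, x, y)" by (rule orb_rigid[OF cyc(2) 3(1) N h(5,6) h(1-4) 3(2)])
    then show ?thesis by simp
  qed
  then show ?thesis using xyz by simp
qed

lemma distinct_rotations:
  fixes a b c :: int
  assumes "\<bar>a\<bar> < c" "\<bar>b\<bar> < c" "\<not> (a = 0 \<and> b = 0)"
  shows "distinct (rotations (a, b, c))"
  using assms by auto

lemma half_turn_neq:
  fixes a b c :: int
  assumes "\<bar>a\<bar> < c" "\<bar>b\<bar> < c" "\<not> (a = 0 \<and> b = 0)" "q \<in> orb (a, b, c)"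
  shows "quarter_turn f (quarter_turn f q) \<noteq> q"
  using assms by (cases f; simp add: orb_def; elim disjE; simp; linarith?)

lemma orb_facelets: "p \<in> facelets n \<Longrightarrow> orb p \<subseteq> facelets n"
  by (cases p) (auto simp: orb_def facelets_iff)

text \<open>
  A move is a product of disjoint 4-cycles. Each of the signed coordinates \<open>\<plusminus>a\<close>, \<open>\<plusminus>b\<close>, \<open>\<plusminus>n\<close> is the
  height over a given face of exactly four facelets of the orbit, so it contributes one 4-cycle if it
  lies in the range of the slice; \<open>v s\<close> counts those among \<open>s\<close> and \<open>-s\<close>.
\<close>

lemma sign_on_orb_move:
  fixes a b :: int
  assumes ab: "a \<in> grid n" "b \<in> grid n" "\<not> (a = 0 \<and> b = 0)"
    and v_def: "v = (\<lambda>s. of_bool (int n - 2 * int k \<le> s \<and> s \<le> int n - 2 * (int k - 1)) +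
      of_bool (int n - 2 * int k \<le> - s \<and> - s \<le> int n - 2 * (int k - 1)) :: nat)"
  shows "sign_on (orb (a, b, int n)) (move n f k) = (-1) ^ (v a + v b + v (int n))"
proof -
  define w :: "int \<Rightarrow> nat" where
    "w = (\<lambda>s. of_bool (int n - 2 * int k \<le> s \<and> s \<le> int n - 2 * (int k - 1)))"
  have v: "v s = w s + w (- s)" for s by (simp add: v_def w_def)
  let ?p = "(a, b, int n)"
  let ?M = "{q \<in> orb ?p. q \<in> slice n f k}"
  let ?m = "restrict_id (move n f k) (orb ?p)"
  have lt: "\<bar>a\<bar> < int n" "\<bar>b\<bar> < int n" using ab by (auto simp: grid_iff)
  have fac: "q \<in> facelets n" if "q \<in> orb ?p" for q
    using that orb_facelets[of ?p n] ab by (auto simp: facelets_iff)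
  have m: "?m q = (if q \<in> ?M then quarter_turn f q else q)" for q
    using fac by (auto simp: restrict_id_def move_def)
  have sub: "move n f k ` orb ?p \<subseteq> orb ?p" by (auto simp: move_def quarter_turn_mem_orb)
  have "?m permutes orb ?p" by (rule permutes_restrict_id_subset[OF move_permutes _ sub]) simp
  then have perm: "?m permutes ?M" by (rule permutes_superset) (auto simp: m)
  have M: "quarter_turn f q \<in> ?M" if "q \<in> ?M" for q
    using that by (simp add: quarter_turn_mem_orb quarter_turn_slice)
  have "sign ?m = (-1) ^ (card ?M div 4)"
  proof (rule sign_fixed_point_free_order_4[OF _ perm])
    show "finite ?M" by simp
    fix q assume q: "q \<in> ?M"
    note q1 = M[OF q] note q2 = M[OF q1] note q3 = M[OF q2]
    show "?m (?m (?m (?m q))) = q" unfolding m using q q1 q2 q3 by (simp only: if_True quarter_turn_4)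
    show "?m (?m q) \<noteq> q" unfolding m using q q1 half_turn_neq[OF lt ab(3), of q f] by (simp only: if_True) blast
  qed
  also have "card ?M = length (filter (\<lambda>q. q \<in> slice n f k) (rotations ?p))"
  proof -
    have "distinct (filter (\<lambda>q. q \<in> slice n f k) (rotations ?p))"
      using distinct_rotations[OF lt ab(3)] by (rule distinct_filter)
    from distinct_card[OF this] show ?thesis by (simp add: orb_def del: rotations.simps)
  qed
  also have "\<dots> = sum_list (map w (map (height f) (rotations ?p)))"
  proof -
    have "length (filter (\<lambda>q. q \<in> slice n f k) qs) = sum_list (map w (map (height f) qs))" for qs
      by (induction qs) (simp_all add: w_def slice_def)
    then show ?thesis .
  qed
  also have "\<dots> = 4 * (v a + v b + v (int n))"
    unfolding v by (cases f) simp_all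
  finally show ?thesis by (simp add: sign_on_def)
qed

lemma cube_group_bij_betw_orb:
  assumes "g \<in> cube_group n"
  shows "bij_betw g (orb p) (orb p)"
proof -
  have "inj_on g (orb p)" using permutes_inj_on[OF cube_group_permutes[OF assms]] by blast
  then show ?thesis
    using endo_inj_surj[OF finite_orb cube_group_image_orb[OF assms]] by (simp add: bij_betw_def)
qed

lemma minus_one_power_cancel:
  "(-1 :: int) ^ (i + j + l) = (-1) ^ (i + m + l) * (-1) ^ (j + m + l) * (-1) ^ (m + m + l)"
proof -
  have "i + m + l + (j + m + l) + (m + m + l) = i + j + l + 2 * (2 * m + l)" by simp
  then show ?thesis by (simp only: power_add[symmetric]) (simp add: power_add power_mult)
qed

lemma sign_on_orb:
  assumes g: "g \<in> cube_group n" and n: "n \<ge> 2" and ab: "a \<in> grid n" "b \<in> grid n" "\<not> (a = 0 \<and> b = 0)"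
  shows "sign_on (orb (a, b, int n)) g = sign_on (orb (a, int n - 1, int n)) g *
    sign_on (orb (b, int n - 1, int n)) g * sign_on (orb (int n - 1, int n - 1, int n)) g"
  using g
proof (induction g rule: cube_group_induct)
  case id
  then show ?case by simp
next
  case (move f k g)
  have comp: "sign_on (orb p) (move n f k \<circ> g) = sign_on (orb p) (move n f k) * sign_on (orb p) g" for p
    by (rule sign_on_compose[OF cube_group_bij_betw_orb[OF move_mem_cube_group[OF move(1,2)]]
      cube_group_bij_betw_orb[OF move(3)] finite_orb])
  define v :: "int \<Rightarrow> nat" where
    "v = (\<lambda>s. of_bool (int n - 2 * int k \<le> s \<and> s \<le> int n - 2 * (int k - 1)) +
      of_bool (int n - 2 * int k \<le> - s \<and> - s \<le> int n - 2 * (int k - 1)))"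
  note mv = sign_on_orb_move[OF _ _ _ v_def, of _ _ f]
  have n1: "int n - 1 \<in> grid n" using n by (auto simp: grid_iff)
  have conj: "\<not> (c = 0 \<and> int n - 1 = 0)" for c :: int using n by simp
  have key: "sign_on (orb (a, b, int n)) (move n f k) = sign_on (orb (a, int n - 1, int n)) (move n f k) *
    sign_on (orb (b, int n - 1, int n)) (move n f k) * sign_on (orb (int n - 1, int n - 1, int n)) (move n f k)"
    unfolding mv[OF ab] mv[OF ab(1) n1(1) conj] mv[OF ab(2) n1(1) conj] mv[OF n1(1) n1(1) conj]
    by (rule minus_one_power_cancel)
  show ?case unfolding comp move.IH key by (simp only: mult_ac)
qed

lemma face_preserving_sign_on_orb:
  assumes g: "g \<in> cube_group n" "\<And>p f. p \<in> face_facelets n f \<Longrightarrow> g p \<in> face_facelets n f"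
    and n: "n \<ge> 2" and ab: "a \<in> grid n" "b \<in> grid n" "\<not> (a = 0 \<and> b = 0)"
  shows "sign_on (orb (a, b, int n)) g = 1"
proof -
  have one: "sign_on (orb (c, int n - 1, int n)) g = 1" if c: "c \<in> grid n" for c
  proof -
    have n1: "int n - 1 \<in> grid n" using n by (auto simp: grid_iff)
    have "g q = id q" if q: "q \<in> orb (c, int n - 1, int n)" for q
    proof -
      obtain x y z where xyz: "q = (x, y, z)" by (cases q)
      have "q \<in> facelets n" using q orb_facelets[of "(c, int n - 1, int n)" n] c n1
        by (auto simp: facelets_iff)
      moreover have "\<bar>x\<bar> = int n - 1 \<or> \<bar>y\<bar> = int n - 1 \<or> \<bar>z\<bar> = int n - 1"
        using q n unfolding xyz by (auto simp: orb_def)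
      ultimately show ?thesis using face_preserving_fixes[OF g n] xyz by simp
    qed
    then have "sign_on (orb (c, int n - 1, int n)) g = sign_on (orb (c, int n - 1, int n)) id"
      by (intro sign_on_cong refl)
    then show ?thesis by simp
  qed
  have "int n - 1 \<in> grid n" using n by (auto simp: grid_iff)
  then show ?thesis using sign_on_orb[OF g(1) n ab] one ab by simp
qed

section \<open>The appearance preserving elements\<close>

lemma mem_face_facelets_iff:
  assumes "p \<in> facelets n"
  shows "p \<in> face_facelets n f \<longleftrightarrow> height f p = int n"
proof
  assume h: "height f p = int n"
  obtain x y z where p: "p = (x, y, z)" by (cases p)
  have ng: "int n \<notin> grid n" "- int n \<notin> grid n" by simp_all
  have "x = int n \<Longrightarrow> f = Right \<Longrightarrow> ?thesis" "- x = int n \<Longrightarrow> f = Left \<Longrightarrow> ?thesis"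
    "y = int n \<Longrightarrow> f = Up \<Longrightarrow> ?thesis" "- y = int n \<Longrightarrow> f = Down \<Longrightarrow> ?thesis"
    "z = int n \<Longrightarrow> f = Front \<Longrightarrow> ?thesis" "- z = int n \<Longrightarrow> f = Back \<Longrightarrow> ?thesis"
    using assms ng unfolding p facelets_iff by (auto simp: grid_iff)
  then show "p \<in> face_facelets n f" using h p by (cases f) auto
qed (rule height_face_facelets)

lemma inner_facelets: "inner n \<subseteq> facelets n"
  by (auto simp: inner_def)

lemma finite_inner: "finite (inner n)"
  using finite_subset[OF inner_facelets finite_facelets] .

lemma orb_inner:
  assumes "p \<in> inner n"
  shows "orb p \<subseteq> inner n"
proof
  fix q assume q: "q \<in> orb p"
  obtain x y z where p: "p = (x, y, z)" by (cases p)
  obtain x' y' z' where q': "q = (x', y', z')" by (cases q)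
  have "q \<in> facelets n" using orb_facelets[of p n] assms q inner_facelets by blast
  moreover have "\<bar>x'\<bar> \<noteq> int n - 1 \<and> \<bar>y'\<bar> \<noteq> int n - 1 \<and> \<bar>z'\<bar> \<noteq> int n - 1 \<and>
    \<not> (x' = 0 \<and> y' = 0) \<and> \<not> (x' = 0 \<and> z' = 0) \<and> \<not> (y' = 0 \<and> z' = 0)"
  proof -
    have P: "\<bar>x\<bar> \<noteq> int n - 1" "\<bar>y\<bar> \<noteq> int n - 1" "\<bar>z\<bar> \<noteq> int n - 1"
      "\<not> (x = 0 \<and> y = 0)" "\<not> (x = 0 \<and> z = 0)" "\<not> (y = 0 \<and> z = 0)"
      using assms unfolding p inner_def by auto
    from q show ?thesis unfolding p q' orb_def rotations.simps
      by (simp; elim disjE; use P in auto)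
  qed
  ultimately show "q \<in> inner n" unfolding q' inner_def by simp
qed

lemma inner_rep:
  assumes "p \<in> inner n"
  obtains a b where "\<bar>a\<bar> < int n - 1" "odd (a + int n)" "a \<noteq> 0" "\<bar>b\<bar> < int n - 1" "odd (b + int n)" "a \<noteq> - b"
    "orb p = orb (a, b, int n)"
proof -
  obtain x y z where p: "p = (x, y, z)" by (cases p)
  have "\<exists>a b. (a, b, int n) \<in> orb p"
  proof -
    have "\<bar>x\<bar> = int n \<or> \<bar>y\<bar> = int n \<or> \<bar>z\<bar> = int n"
      using assms unfolding p by (auto simp: inner_def facelets_iff)
    then have "x = int n \<or> x = - int n \<or> y = int n \<or> y = - int n \<or> z = int n \<or> z = - int n"
      by linarith
    moreover have "(y, z, x) \<in> orb p" "(y, - z, - x) \<in> orb p" "(z, x, y) \<in> orb p" "(z, - x, - y) \<in> orb p"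
      "(x, y, z) \<in> orb p" "(x, - y, - z) \<in> orb p" unfolding p orb_def by simp_all
    ultimately show ?thesis by (elim disjE) (metis minus_minus)+
  qed
  then obtain a b where ab: "(a, b, int n) \<in> orb p" by blast
  then have "(a, b, int n) \<in> inner n" using orb_inner[OF assms] by blast
  then have *: "a \<in> grid n" "b \<in> grid n" "\<bar>a\<bar> \<noteq> int n - 1" "\<bar>b\<bar> \<noteq> int n - 1" "\<not> (a = 0 \<and> b = 0)"
    by (auto simp: inner_def facelets_iff)
  have c: "\<bar>a\<bar> < int n - 1" "odd (a + int n)" "\<bar>b\<bar> < int n - 1" "odd (b + int n)"
    using * by (auto simp: grid_iff)
  show ?thesis
  proof (cases "a \<noteq> 0 \<and> a \<noteq> - b")
    case True
    then show ?thesis using that c orb_eq[OF ab] by metis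
  next
    case False
    have "(b, - a, int n) \<in> orb (a, b, int n)" by (simp add: orb_def)
    then have "orb p = orb (b, - a, int n)" using orb_eq[OF ab] orb_eq by metis
    moreover have "b \<noteq> 0" "b \<noteq> - (- a)" "\<bar>- a\<bar> < int n - 1" "odd (- a + int n)"
      using False c *(5) by auto
    ultimately show ?thesis using that[of b "- a"] c by blast
  qed
qed

lemma contains_alt_orb: "p \<in> inner n \<Longrightarrow> cube_group.contains_alt n (orb p)"
  using inner_rep[of p n] contains_alt_orb_rep by metis

lemma cube_group_fixes_centre:
  assumes g: "g \<in> cube_group n" and p: "(x, y, z) \<in> facelets n"
    and c: "x = 0 \<and> y = 0 \<or> x = 0 \<and> z = 0 \<or> y = 0 \<and> z = 0"
  shows "g (x, y, z) = (x, y, z)"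
  using g
proof (induction g rule: cube_group_induct)
  case id
  then show ?case by simp
next
  case (move f k g)
  have "move n f k (x, y, z) = (x, y, z)"
  proof (cases "(x, y, z) \<in> slice n f k")
    case True
    have n: "n > 0" "2 * int k \<le> int n" using move by auto
    have "0 \<in> grid n" using p c n(1) by (auto simp: facelets_iff)
    then have "odd n" by (simp add: grid_iff)
    then have "2 * int k \<noteq> int n" by presburger
    then have lo: "height f (x, y, z) > 0" using True n by (auto simp: slice_def)
    have "quarter_turn f (x, y, z) = (x, y, z)" using lo c by (cases f) auto
    then show ?thesis by (simp add: move_def)
  qed (simp add: move_def)
  then show ?case using move.IH by simp
qed

lemma face_preserving_permutes_inner:
  assumes g: "g \<in> cube_group n" "\<And>p f. p \<in> face_facelets n f \<Longrightarrow> g p \<in> face_facelets n f" and n: "n \<ge> 2"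
  shows "g permutes inner n"
proof (rule permutes_superset[OF cube_group_permutes[OF g(1)]])
  fix p assume p: "p \<in> facelets n - inner n"
  obtain x y z where xyz: "p = (x, y, z)" by (cases p)
  have fac: "(x, y, z) \<in> facelets n" using p xyz by simp
  have "\<bar>x\<bar> = int n - 1 \<or> \<bar>y\<bar> = int n - 1 \<or> \<bar>z\<bar> = int n - 1 \<or>
    (x = 0 \<and> y = 0 \<or> x = 0 \<and> z = 0 \<or> y = 0 \<and> z = 0)"
    using p unfolding xyz inner_def by auto
  then show "g p = p"
    using face_preserving_fixes[OF g n fac] cube_group_fixes_centre[OF g(1) fac] xyz by blast
qed

definition orbits :: "nat \<Rightarrow> facelet set set" where
  "orbits n = orb ` inner n"

definition face_perms :: "nat \<Rightarrow> facelet set \<Rightarrow> (facelet \<Rightarrow> facelet) set" where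
  "face_perms n S = {h. h permutes S \<and> (\<forall>f. h ` (S \<inter> face_facelets n f) \<subseteq> S \<inter> face_facelets n f)}"

lemma finite_orbits: "finite (orbits n)"
  by (simp add: orbits_def finite_inner)

lemma Union_orbits: "\<Union> (orbits n) = inner n"
  using orb_inner self_mem_orb unfolding orbits_def by blast

lemma orbits_disjoint:
  assumes "A \<in> orbits n" "B \<in> orbits n" "A \<noteq> B"
  shows "A \<inter> B = {}"
proof (rule ccontr)
  assume "A \<inter> B \<noteq> {}"
  then obtain q where q: "q \<in> A" "q \<in> B" by blast
  obtain p p' where "A = orb p" "B = orb p'" using assms unfolding orbits_def by blast
  then show False using q orb_eq assms(3) by metis
qed

lemma orbits_rep:
  assumes "O' \<in> orbits n"
  obtains a b where "\<bar>a\<bar> < int n - 1" "odd (a + int n)" "a \<noteq> 0" "\<bar>b\<bar> < int n - 1" "odd (b + int n)"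
    "O' = orb (a, b, int n)"
proof -
  from assms obtain p where "p \<in> inner n" "O' = orb p" unfolding orbits_def by blast
  then show ?thesis using inner_rep[of p n] that by metis
qed

lemma orbits_facelets: "O' \<in> orbits n \<Longrightarrow> O' \<subseteq> facelets n"
  using Union_orbits inner_facelets by blast

lemma card_orbit_face:
  assumes "O' \<in> orbits n"
  shows "card (O' \<inter> face_facelets n f) = 4"
proof -
  obtain a b where ab: "\<bar>a\<bar> < int n - 1" "a \<noteq> 0" "\<bar>b\<bar> < int n - 1" "O' = orb (a, b, int n)"
    using orbits_rep[OF assms] by metis
  have "O' \<inter> face_facelets n f = {q \<in> O'. height f q = int n}"
    using mem_face_facelets_iff orbits_facelets[OF assms] by blast
  also have "\<dots> = set (filter (\<lambda>q. height f q = int n) (rotations (a, b, int n)))"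
    by (simp add: ab(4) orb_def del: rotations.simps)
  also have "card \<dots> = length (filter (\<lambda>q. height f q = int n) (rotations (a, b, int n)))"
    by (rule distinct_card, rule distinct_filter, rule distinct_rotations) (use ab in auto)
  also have "\<dots> = 4"
  proof -
    have ne: "a \<noteq> int n" "- a \<noteq> int n" "b \<noteq> int n" "- b \<noteq> int n" "n > 0"
      using ab by auto
    show ?thesis by (cases f) (simp_all add: ne)
  qed
  finally show ?thesis .
qed

lemma orbit_eq_UN_faces: "O' \<in> orbits n \<Longrightarrow> O' = (\<Union>f\<in>UNIV. O' \<inter> face_facelets n f)"
  using orbits_facelets[of O' n] unfolding facelets_def by blast

lemma card_face_perms:
  assumes O': "O' \<in> orbits n"
  shows "card (face_perms n O') = 24 ^ 6"
proof -
  let ?A = "\<lambda>f. O' \<inter> face_facelets n f"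
  have fin: "finite (?A f)" for f using finite_face_facelets by blast
  have "face_perms n O' = {h. h permutes (\<Union>f\<in>UNIV. ?A f) \<and> (\<forall>f\<in>UNIV. h ` ?A f \<subseteq> ?A f \<and> True)}"
    unfolding face_perms_def orbit_eq_UN_faces[OF O', symmetric] by simp
  also have "card \<dots> = (\<Prod>f\<in>UNIV. card {h. h permutes ?A f \<and> True})"
  proof (rule card_permutes_preserving_partition)
    show "finite (UNIV :: cube_face set)" by (simp add: UNIV_cube_face)
    show "disjoint_family_on ?A UNIV"
      unfolding disjoint_family_on_def using face_facelets_disjoint by blast
  qed (rule fin)
  also have "\<dots> = (\<Prod>f::cube_face\<in>UNIV. 24)"
    using fin card_orbit_face[OF O'] by (intro prod.cong) (simp_all add: card_permutations fact_numeral)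
  also have "\<dots> = 24 ^ 6" by (simp add: UNIV_cube_face)
  finally show ?thesis .
qed

lemma card_even_face_perms:
  assumes O': "O' \<in> orbits n"
  shows "card {h \<in> face_perms n O'. evenperm h} = 24 ^ 6 div 2"
proof -
  have "card (O' \<inter> face_facelets n Front) = 4" by (rule card_orbit_face[OF O'])
  then have "\<not> card (O' \<inter> face_facelets n Front) \<le> Suc 0" by simp
  moreover have fin: "finite (O' \<inter> face_facelets n Front)" using finite_face_facelets by blast
  ultimately obtain x y where xy: "x \<in> O' \<inter> face_facelets n Front" "y \<in> O' \<inter> face_facelets n Front" "x \<noteq> y"
    using card_le_Suc0_iff_eq[OF fin] by blast
  have "card {h \<in> face_perms n O'. evenperm h} = card (face_perms n O') div 2"
  proof (rule card_even_half[of O'])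
    show "finite O'" using O' by (auto simp: orbits_def)
    show "h permutes O'" if "h \<in> face_perms n O'" for h using that by (simp add: face_perms_def)
    show "x \<noteq> y" by fact
    fix h assume h: "h \<in> face_perms n O'"
    have "transpose x y \<circ> h permutes O'"
      using h xy by (intro permutes_compose permutes_swap_id) (auto simp: face_perms_def)
    moreover have "transpose x y q \<in> O' \<inter> face_facelets n f" if "q \<in> O' \<inter> face_facelets n f" for q f
    proof (cases "f = Front")
      case True
      then show ?thesis using that xy by (auto simp: transpose_def)
    next
      case False
      then have "q \<noteq> x" "q \<noteq> y" using that xy face_facelets_disjoint by blast+
      then show ?thesis using that by simp
    qed
    moreover have "h q \<in> O' \<inter> face_facelets n f" if "q \<in> O' \<inter> face_facelets n f" for q f
      using h that unfolding face_perms_def by blast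
    ultimately have "(transpose x y \<circ> h) ` (O' \<inter> face_facelets n f) \<subseteq> O' \<inter> face_facelets n f" for f
      unfolding comp_def by blast
    with \<open>transpose x y \<circ> h permutes O'\<close> show "transpose x y \<circ> h \<in> face_perms n O'"
      unfolding face_perms_def by blast
  qed
  then show ?thesis using card_face_perms[OF O'] by simp
qed

lemma card_inner_front:
  assumes "n \<ge> 2"
  shows "card (inner n \<inter> face_facelets n Front) = (n - 2) ^ 2 - (if odd n then 1 else 0)"
proof -
  define J where "J = grid n - {int n - 1, - (int n - 1)}"
  have "int n - 1 \<in> grid n" "- (int n - 1) \<in> grid n" "int n - 1 \<noteq> - (int n - 1)"
    using assms by (auto simp: grid_iff)
  then have cardJ: "card J = n - 2" unfolding J_def by (subst card_Diff_subset) (simp_all add: card_grid)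
  have J0: "0 \<in> J \<longleftrightarrow> odd n" using assms by (auto simp: J_def grid_iff)
  have finJ: "finite J" by (simp add: J_def)
  have J: "u \<in> J \<longleftrightarrow> u \<in> grid n \<and> \<bar>u\<bar> \<noteq> int n - 1" for u
    using assms by (auto simp: J_def)
  have "inner n \<inter> face_facelets n Front = (\<lambda>(u, v). (u, v, int n)) ` (J \<times> J - {(0, 0)})"
  proof (intro equalityI subsetI)
    fix p assume "p \<in> inner n \<inter> face_facelets n Front"
    moreover from this obtain u v where p: "p = (u, v, int n)" by auto
    ultimately have "(u, v) \<in> J \<times> J - {(0, 0)}" by (auto simp: inner_def J)
    then show "p \<in> (\<lambda>(u, v). (u, v, int n)) ` (J \<times> J - {(0, 0)})"
      unfolding p by (rule rev_image_eqI) simp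
  next
    fix p assume "p \<in> (\<lambda>(u, v). (u, v, int n)) ` (J \<times> J - {(0, 0)})"
    then show "p \<in> inner n \<inter> face_facelets n Front"
      using assms by (auto simp: inner_def J facelets_iff)
  qed
  also have "card \<dots> = card (J \<times> J - {(0, 0)})"
    by (rule card_image) (auto simp: inj_on_def)
  also have "\<dots> = (n - 2) ^ 2 - (if odd n then 1 else 0)"
    using finJ J0 by (simp add: card_Diff_singleton_if card_cartesian_product cardJ power2_eq_square)
  finally show ?thesis .
qed

lemma card_orbits:
  assumes "n \<ge> 2"
  shows "4 * card (orbits n) = (n - 2) ^ 2 - (if odd n then 1 else 0)"
proof -
  have "inner n \<inter> face_facelets n Front = (\<Union>O'\<in>orbits n. O' \<inter> face_facelets n Front)"
    unfolding Union_orbits[symmetric] by blast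
  moreover have "card (\<Union>O'\<in>orbits n. O' \<inter> face_facelets n Front) =
    (\<Sum>O'\<in>orbits n. card (O' \<inter> face_facelets n Front))"
  proof (rule card_UN_disjoint[OF finite_orbits])
    show "\<forall>O'\<in>orbits n. finite (O' \<inter> face_facelets n Front)" using finite_face_facelets by blast
    show "\<forall>A\<in>orbits n. \<forall>B\<in>orbits n. A \<noteq> B \<longrightarrow> A \<inter> face_facelets n Front \<inter> (B \<inter> face_facelets n Front) = {}"
      using orbits_disjoint by blast
  qed
  moreover have "\<dots> = (\<Sum>O'\<in>orbits n. 4)" by (intro sum.cong refl card_orbit_face)
  ultimately show ?thesis using card_inner_front[OF assms] by simp
qed

definition even_face_perms :: "nat \<Rightarrow> (facelet \<Rightarrow> facelet) set" where
  "even_face_perms n = {g. g permutes (\<Union>O'\<in>orbits n. O') \<and> (\<forall>O'\<in>orbits n. g ` O' \<subseteq> O' \<and>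
    restrict_id g O' \<in> {h \<in> face_perms n O'. evenperm h})}"

lemma card_even_face_perms_all: "card (even_face_perms n) = (24 ^ 6 div 2) ^ card (orbits n)"
proof -
  have "card (even_face_perms n) =
    (\<Prod>O'\<in>orbits n. card {h. h permutes O' \<and> h \<in> {h \<in> face_perms n O'. evenperm h}})"
    unfolding even_face_perms_def
  proof (rule card_permutes_preserving_partition[OF finite_orbits])
    show "finite O'" if "O' \<in> orbits n" for O' using that by (auto simp: orbits_def)
    show "disjoint_family_on (\<lambda>O'. O') (orbits n)"
      using orbits_disjoint by (auto simp: disjoint_family_on_def)
  qed
  also have "\<dots> = (\<Prod>O'\<in>orbits n. 24 ^ 6 div 2)"
  proof (rule prod.cong[OF refl])
    fix O' assume O': "O' \<in> orbits n"
    have "{h. h permutes O' \<and> h \<in> {h \<in> face_perms n O'. evenperm h}} = {h \<in> face_perms n O'. evenperm h}"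
      by (auto simp: face_perms_def)
    then show "card {h. h permutes O' \<and> h \<in> {h \<in> face_perms n O'. evenperm h}} = 24 ^ 6 div 2"
      using card_even_face_perms[OF O'] by simp
  qed
  finally show ?thesis by simp
qed

lemma face_preserving_iff_appearance:
  assumes "inj col" "g permutes facelets n"
  shows "(\<forall>q\<in>facelets n. apply_to n g (solved n col) q = solved n col q) \<longleftrightarrow>
    (\<forall>f. \<forall>p\<in>face_facelets n f. g p \<in> face_facelets n f)"
proof -
  have inv: "inv_into (facelets n) g (g p) = p" if "p \<in> facelets n" for p
    using inv_into_f_f[OF permutes_inj_on[OF assms(2)] that] .
  have "(\<forall>q\<in>facelets n. apply_to n g (solved n col) q = solved n col q) \<longleftrightarrow>
    (\<forall>q\<in>g ` facelets n. apply_to n g (solved n col) q = solved n col q)"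
    by (simp add: permutes_image[OF assms(2)])
  also have "\<dots> \<longleftrightarrow> (\<forall>p\<in>facelets n. solved n col p = solved n col (g p))"
    using inv by (simp add: apply_to_def)
  also have "\<dots> \<longleftrightarrow> (\<forall>f. \<forall>p\<in>face_facelets n f. g p \<in> face_facelets n f)"
  proof
    assume L: "\<forall>p\<in>facelets n. solved n col p = solved n col (g p)"
    show "\<forall>f. \<forall>p\<in>face_facelets n f. g p \<in> face_facelets n f"
    proof (intro allI ballI)
      fix f p assume p: "p \<in> face_facelets n f"
      then have fac: "p \<in> facelets n" unfolding facelets_def by blast
      then have "g p \<in> facelets n" using permutes_in_image[OF assms(2)] by blast
      then obtain f' where f': "g p \<in> face_facelets n f'" unfolding facelets_def by blast
      have "col f = col f'" using L[rule_format, OF fac] solved_eq[OF p] solved_eq[OF f'] by metis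
      then show "g p \<in> face_facelets n f" using f' injD[OF assms(1)] by metis
    qed
  next
    assume R: "\<forall>f. \<forall>p\<in>face_facelets n f. g p \<in> face_facelets n f"
    show "\<forall>p\<in>facelets n. solved n col p = solved n col (g p)"
    proof
      fix p assume "p \<in> facelets n"
      then obtain f where f: "p \<in> face_facelets n f" unfolding facelets_def by blast
      then show "solved n col p = solved n col (g p)" using R solved_eq by metis
    qed
  qed
  finally show ?thesis .
qed

lemma even_face_perms_mem:
  assumes g: "g \<in> even_face_perms n"
  shows "g \<in> cube_group n"
proof -
  have perm: "g permutes inner n" and inv: "\<And>O'. O' \<in> orbits n \<Longrightarrow> g ` O' \<subseteq> O'"
    and restr: "\<And>O'. O' \<in> orbits n \<Longrightarrow> restrict_id g O' \<in> face_perms n O' \<and> evenperm (restrict_id g O')"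
    using g Union_orbits[of n] unfolding even_face_perms_def by auto
  have "restrict_id g (\<Union>C) \<in> cube_group n" if "finite C" "C \<subseteq> orbits n" for C
    using that
  proof (induction C rule: finite_induct)
    case empty
    have "restrict_id g (\<Union>{}) = id" by (auto simp: restrict_id_def)
    show ?case unfolding \<open>restrict_id g (\<Union>{}) = id\<close> by (rule cube_group.id_mem)
  next
    case (insert A C)
    have "restrict_id g A \<in> cube_group n"
    proof -
      obtain p where p: "p \<in> inner n" "A = orb p" using insert.prems unfolding orbits_def by blast
      then show ?thesis using contains_alt_orb[OF p(1)] restr[of A] insert.prems
        unfolding cube_group.contains_alt_def face_perms_def by blast
    qed
    moreover have "restrict_id g (\<Union>C) \<in> cube_group n" using insert by blast
    moreover have "restrict_id g (\<Union>(insert A C)) = restrict_id g A \<circ> restrict_id g (\<Union>C)"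
    proof
      fix x
      show "restrict_id g (\<Union>(insert A C)) x = (restrict_id g A \<circ> restrict_id g (\<Union>C)) x"
      proof (cases "x \<in> \<Union>C")
        case True
        then obtain B where B: "B \<in> C" "x \<in> B" by blast
        then have "g x \<in> B" "A \<inter> B = {}" using inv insert orbits_disjoint[of A n B] by blast+
        then have "g x \<notin> A" by blast
        then show ?thesis using True by (simp add: restrict_id_def)
      next
        case False
        then show ?thesis by (simp add: restrict_id_def)
      qed
    qed
    ultimately show ?case using cube_group.comp_mem by metis
  qed
  from this[OF finite_orbits] have "restrict_id g (inner n) \<in> cube_group n"
    by (simp add: Union_orbits)
  moreover have "restrict_id g (inner n) = g"
    using permutes_not_in[OF perm] by (auto simp: restrict_id_def)
  ultimately show ?thesis by metis
qed

lemma appearance_preserving_eq: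
  assumes "inj col" "n \<ge> 2"
  shows "appearance_preserving n col = even_face_perms n"
proof (intro equalityI subsetI)
  fix g assume "g \<in> appearance_preserving n col"
  then have g: "g \<in> cube_group n" and face: "\<And>p f. p \<in> face_facelets n f \<Longrightarrow> g p \<in> face_facelets n f"
    using face_preserving_iff_appearance[OF assms(1) cube_group_permutes, of g n]
    unfolding appearance_preserving_def by blast+
  show "g \<in> even_face_perms n"
    unfolding even_face_perms_def mem_Collect_eq
  proof (intro conjI ballI)
    show "g permutes (\<Union>O'\<in>orbits n. O')"
      using face_preserving_permutes_inner[OF g face assms(2)] Union_orbits by simp
    fix O' assume O': "O' \<in> orbits n"
    obtain a b where ab: "\<bar>a\<bar> < int n - 1" "odd (a + int n)" "a \<noteq> 0" "\<bar>b\<bar> < int n - 1" "odd (b + int n)"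
      "O' = orb (a, b, int n)" using orbits_rep[OF O'] by metis
    show sub: "g ` O' \<subseteq> O'" using cube_group_image_orb[OF g] ab(6) by simp
    have "sign_on O' g = 1" unfolding ab(6)
      by (rule face_preserving_sign_on_orb[OF g face assms(2)]) (use ab in \<open>auto simp: grid_iff\<close>)
    then show "evenperm (restrict_id g O')" unfolding sign_on_def sign_def by (simp split: if_splits)
    have "restrict_id g O' permutes O'"
      by (rule permutes_restrict_id_subset[OF cube_group_permutes[OF g] _ sub]) (simp add: ab(6))
    moreover have "restrict_id g O' q \<in> O' \<inter> face_facelets n f" if "q \<in> O' \<inter> face_facelets n f" for q f
      using that sub face by (auto simp: restrict_id_def)
    ultimately show "restrict_id g O' \<in> face_perms n O'" unfolding face_perms_def by blast
  qed
next
  fix g assume g: "g \<in> even_face_perms n"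
  then have G: "g \<in> cube_group n" by (rule even_face_perms_mem)
  have perm: "g permutes inner n" using g Union_orbits[of n] unfolding even_face_perms_def by auto
  have "g p \<in> face_facelets n f" if p: "p \<in> face_facelets n f" for p f
  proof (cases "p \<in> inner n")
    case True
    then obtain O' where O': "O' \<in> orbits n" "p \<in> O'" using Union_orbits by blast
    then have "restrict_id g O' p \<in> face_facelets n f"
      using g p unfolding even_face_perms_def face_perms_def by blast
    then show ?thesis using O' by (simp add: restrict_id_def)
  next
    case False
    then show ?thesis using permutes_not_in[OF perm] p by simp
  qed
  then show "g \<in> appearance_preserving n col"
    using face_preserving_iff_appearance[OF assms(1) cube_group_permutes[OF G]] G
    unfolding appearance_preserving_def by blast
qed

theorem theorem19:
  fixes n :: nat and col :: "cube_face \<Rightarrow> 'c"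
  assumes "inj col"
  shows "(odd n \<and> n \<ge> 3 \<longrightarrow>
            card (appearance_preserving n col) = (24 ^ 6 div 2) ^ ((n - 3) * (n - 1) div 4)) \<and>
         (even n \<and> n \<ge> 2 \<longrightarrow>
            card (appearance_preserving n col) = (24 ^ 6 div 2) ^ ((n - 2) ^ 2 div 4))"
proof -
  have card: "card (appearance_preserving n col) = (24 ^ 6 div 2) ^ card (orbits n)" if "n \<ge> 2"
    using appearance_preserving_eq[OF assms that] card_even_face_perms_all by metis
  have "card (orbits n) = (n - 3) * (n - 1) div 4" if "odd n" and n3: "n \<ge> 3"
  proof -
    obtain m where m: "n = m + 3" using n3 by (metis add.commute le_Suc_ex)
    have "4 * card (orbits n) = (m + 1) ^ 2 - 1" using card_orbits[of n] \<open>odd n\<close> by (simp add: m)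
    also have "\<dots> = m * (m + 2)" by (simp add: power2_eq_square)
    finally show ?thesis by (simp add: m)
  qed
  moreover have "card (orbits n) = (n - 2) ^ 2 div 4" if "even n" "n \<ge> 2"
    using card_orbits[of n] that by simp
  ultimately show ?thesis using card by simp
qed

end
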